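(* (In $\mathsf{ZF}+\mathsf{DC}$.) Assume Turing Determinacy ($\mathsf{TD}$) and let $f:2^{\mathbb N}\to 2^{\mathbb N}$ be uniformly Turing invariant on a cone. Then either $f(x)\ge_T x$ on a cone, or there exists $y\in 2^{\mathbb N}$ such that $f(x)=y$ on a cone.
   Context: $\le_T$ and $\equiv_T$ denote Turing reducibility and Turing equivalence. A cone is a set of the form $\{x\in 2^{\mathbb N} : x\ge_T z\}$ for some $z\in 2^{\mathbb N}$. A property holds "on a cone" if there is a cone such that it holds for all $x$ in that cone. $\mathsf{TD}$ is the statement: every $A\subseteq 2^{\mathbb N}$ which is closed under $\equiv_T$ either contains a cone or is disjoint from a cone. $(\varphi_i^x)_{i\in\mathbb N}$ is the standard numbering of the partial unary computable-in-$x$ functions. For $x,y\in 2^{\mathbb N}$: $x\le_T y$ via $i$ means $x=\varphi_i^y$; and $x\equiv_T y$ via $(i,j)$ means $x\ge_T y$ via $i$ and $x\le_T y$ via $j$, i.e. $y=\varphi_i^x$ and $x=\varphi_j^y$. A function $f:A\to 2^{\mathbb N}$ with $A\subseteq 2^{\mathbb N}$ is uniformly Turing invariant (UTI) if there is a function $u:\mathbb N^2\to\mathbb N^2$ such that for all $x,y\in A$ and all $(i,j)\in\mathbb N^2$: $x\equiv_T y$ via $(i,j)$ implies $f(x)\equiv_T f(y)$ via $u(i,j)$. A function $f:2^{\mathbb N}\to 2^{\mathbb N}$ is UTI on a cone if its restriction to some cone is UTI. *)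

theory Defs
  imports Main
begin

text \<open>
  The theorem belongs to \<open>ZF + DC\<close>. In HOL itself it would be void: HOL proves the axiom of choice,
  and choice refutes Turing determinacy for arbitrary sets of reals. It is therefore stated as
  a semantic consequence of the first-order theory \<open>ZF + DC\<close>: it holds in every structure
  \<open>(V, \<epsilon>)\<close> satisfying these axioms. By the completeness theorem this is the same as provability.

  Every notion below is the internal one of the structure: all quantifiers except those over
  formulas, assignments and the numerals \<open>num k\<close> range over elements of the structure. In particular
  the natural numbers are the elements of the structure's own \<open>omega\<close>, which may be nonstandard,
  so inductively generated sets are obtained as intersections inside the structure and not
  by HOL's inductive definitions.
\<close>

section \<open>Structures for the language of set theory\<close>

datatype fm = Mem nat nat | Equal nat nat | Neg fm | Conj fm fm | Forall nat fm

locale set_structure =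
  fixes mem :: "'v \<Rightarrow> 'v \<Rightarrow> bool"  (infix "\<epsilon>" 50)
begin

primrec sat :: "fm \<Rightarrow> (nat \<Rightarrow> 'v) \<Rightarrow> bool" where
  "sat (Mem i j) env \<longleftrightarrow> env i \<epsilon> env j"
| "sat (Equal i j) env \<longleftrightarrow> env i = env j"
| "sat (Neg p) env \<longleftrightarrow> \<not> sat p env"
| "sat (Conj p q) env \<longleftrightarrow> sat p env \<and> sat q env"
| "sat (Forall i p) env \<longleftrightarrow> (\<forall>a. sat p (env(i := a)))"

text \<open>
  \<open>coll P\<close> is the set \<open>{x. P x}\<close> of the structure. It is meaningful only if that class is a set
  (which is then unique by extensionality). In models of \<open>ZF\<close> this is the case wherever
  \<open>coll\<close> is used below.
\<close>

definition coll :: "('v \<Rightarrow> bool) \<Rightarrow> 'v" where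
  "coll P = (THE s. \<forall>x. x \<epsilon> s \<longleftrightarrow> P x)"

definition upair :: "'v \<Rightarrow> 'v \<Rightarrow> 'v" where
  "upair a b = coll (\<lambda>x. x = a \<or> x = b)"

definition opair :: "'v \<Rightarrow> 'v \<Rightarrow> 'v" where
  "opair a b = upair (upair a a) (upair a b)"

definition prod_set :: "'v \<Rightarrow> 'v \<Rightarrow> 'v" where
  "prod_set A B = coll (\<lambda>p. \<exists>a b. a \<epsilon> A \<and> b \<epsilon> B \<and> p = opair a b)"

definition is_fun :: "'v \<Rightarrow> 'v \<Rightarrow> 'v \<Rightarrow> bool" where
  "is_fun f A B \<longleftrightarrow>
     (\<forall>p. p \<epsilon> f \<longrightarrow> (\<exists>a b. a \<epsilon> A \<and> b \<epsilon> B \<and> p = opair a b)) \<and>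
     (\<forall>a. a \<epsilon> A \<longrightarrow> (\<exists>!b. opair a b \<epsilon> f))"

definition app :: "'v \<Rightarrow> 'v \<Rightarrow> 'v" where
  "app f a = (THE b. opair a b \<epsilon> f)"

definition restr :: "'v \<Rightarrow> 'v \<Rightarrow> 'v" where
  "restr f A = coll (\<lambda>p. p \<epsilon> f \<and> (\<exists>a b. a \<epsilon> A \<and> p = opair a b))"

definition succ :: "'v \<Rightarrow> 'v" where
  "succ a = coll (\<lambda>x. x \<epsilon> a \<or> x = a)"

primrec num :: "nat \<Rightarrow> 'v" where
  "num 0 = coll (\<lambda>x. False)"
| "num (Suc k) = succ (num k)"

definition omega :: 'v where
  "omega = coll (\<lambda>n. \<forall>I. num 0 \<epsilon> I \<and> (\<forall>x. x \<epsilon> I \<longrightarrow> succ x \<epsilon> I) \<longrightarrow> n \<epsilon> I)"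

end


section \<open>The axioms of ZF and DC\<close>

text \<open>In the two schemes the assignment \<open>env\<close> supplies the parameters.\<close>

locale ZF = set_structure +
  assumes extensionality: "(\<forall>z. z \<epsilon> x \<longleftrightarrow> z \<epsilon> y) \<Longrightarrow> x = y"
    and foundation: "(\<exists>y. y \<epsilon> x) \<Longrightarrow> \<exists>y. y \<epsilon> x \<and> \<not> (\<exists>z. z \<epsilon> x \<and> z \<epsilon> y)"
    and pairing: "\<exists>z. \<forall>w. w \<epsilon> z \<longleftrightarrow> w = x \<or> w = y"
    and union: "\<exists>u. \<forall>z. z \<epsilon> u \<longleftrightarrow> (\<exists>y. y \<epsilon> x \<and> z \<epsilon> y)"
    and power_set: "\<exists>p. \<forall>y. y \<epsilon> p \<longleftrightarrow> (\<forall>z. z \<epsilon> y \<longrightarrow> z \<epsilon> x)"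
    and infinity: "\<exists>I. (\<exists>e. e \<epsilon> I \<and> (\<forall>x. \<not> x \<epsilon> e)) \<and>
          (\<forall>x. x \<epsilon> I \<longrightarrow> (\<exists>y. y \<epsilon> I \<and> (\<forall>z. z \<epsilon> y \<longleftrightarrow> z \<epsilon> x \<or> z = x)))"
    and separation: "\<exists>y. \<forall>z. z \<epsilon> y \<longleftrightarrow> z \<epsilon> x \<and> sat \<phi> (env(0 := z))"
    and replacement: "(\<forall>z. z \<epsilon> x \<longrightarrow> (\<exists>!w. sat \<phi> (env(0 := z, 1 := w)))) \<Longrightarrow>
          \<exists>y. \<forall>w. w \<epsilon> y \<longleftrightarrow> (\<exists>z. z \<epsilon> x \<and> sat \<phi> (env(0 := z, 1 := w)))"

locale ZF_DC = ZF +
  assumes dependent_choice: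
    "\<lbrakk>\<exists>a. a \<epsilon> X; \<forall>a. a \<epsilon> X \<longrightarrow> (\<exists>b. b \<epsilon> X \<and> opair a b \<epsilon> R)\<rbrakk> \<Longrightarrow>
     \<exists>s. is_fun s omega X \<and> (\<forall>n. n \<epsilon> omega \<longrightarrow> opair (app s n) (app s (succ n)) \<epsilon> R)"


section \<open>Oracle computability\<close>

context set_structure
begin

text \<open>The space \<open>2^\<nat>\<close>; note that \<open>num 2 = {0, 1}\<close>.\<close>

definition cantor :: 'v where
  "cantor = coll (\<lambda>x. is_fun x omega (num 2))"

text \<open>
  \<open>code a b\<close> is Cantor's bijection \<open>(a + b) * (a + b + 1) / 2 + a\<close> of \<open>omega \<times> omega\<close> with \<open>omega\<close>,
  given by its enumeration \<open>(0,0), (0,1), (1,0), (0,2), (1,1), (2,0), \<dots>\<close>.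
\<close>

definition code_closed :: "'v \<Rightarrow> bool" where
  "code_closed P \<longleftrightarrow>
     opair (num 0) (opair (num 0) (num 0)) \<epsilon> P \<and>
     (\<forall>a b c. a \<epsilon> omega \<and> b \<epsilon> omega \<and> c \<epsilon> omega \<longrightarrow>
        (opair a (opair (succ b) c) \<epsilon> P \<longrightarrow> opair (succ a) (opair b (succ c)) \<epsilon> P) \<and>
        (opair a (opair (num 0) c) \<epsilon> P \<longrightarrow> opair (num 0) (opair (succ a) (succ c)) \<epsilon> P))"

definition code :: "'v \<Rightarrow> 'v \<Rightarrow> 'v" where
  "code a b = (THE c. \<forall>P. code_closed P \<longrightarrow> opair a (opair b c) \<epsilon> P)"

text \<open>
  The numbering of the partial unary functions computable in \<open>x\<close>. An index is \<open>code (num t) a\<close>,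
  where \<open>t\<close> is the kind of the program and \<open>a\<close> (or \<open>code a b\<close>) lists its immediate subprograms:
  0 zero, 1 successor, 2 and 3 the projections of a coded pair, 4 query of the oracle, 5 pairing,
  6 composition, 7 primitive recursion, 8 unbounded search (for the least \<open>m \<ge> k\<close> with
  \<open>\<phi>\<^sub>a(n, m) = 0\<close>, all values before it being defined), 9 the enumeration scheme
  \<open>(e, n) \<mapsto> \<phi>\<^sub>e(n)\<close> of Kleene (S9). By the enumeration theorem scheme 9 adds no new functions;
  it makes the numbering's universal function explicit. Since the function \<open>u\<close> in uniform Turing
  invariance is arbitrary, that notion is the same for any two numberings which translate into each
  other, in particular for all acceptable numberings. Numbers that are not indices of these
  kinds are indices of the nowhere defined function.

  \<open>C\<close> is a set of triples \<open>(e, n, m)\<close>, read as \<open>\<phi>\<^sub>e(n) = m\<close>.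
\<close>

definition computes_in :: "'v \<Rightarrow> 'v \<Rightarrow> 'v \<Rightarrow> 'v \<Rightarrow> bool" where
  "computes_in C e n m \<longleftrightarrow> opair e (opair n m) \<epsilon> C"

definition phi_closed :: "'v \<Rightarrow> 'v \<Rightarrow> bool" where
  "phi_closed x C \<longleftrightarrow>
    (\<forall>a b n k l m. a \<epsilon> omega \<and> b \<epsilon> omega \<and> n \<epsilon> omega \<and> k \<epsilon> omega \<and> l \<epsilon> omega \<and> m \<epsilon> omega \<longrightarrow>
      computes_in C (code (num 0) a) n (num 0) \<and>
      computes_in C (code (num 1) a) n (succ n) \<and>
      computes_in C (code (num 2) a) (code n k) n \<and>
      computes_in C (code (num 3) a) (code n k) k \<and>
      computes_in C (code (num 4) a) n (app x n) \<and>
      (computes_in C a n k \<and> computes_in C b n m \<longrightarrow>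
        computes_in C (code (num 5) (code a b)) n (code k m)) \<and>
      (computes_in C b n k \<and> computes_in C a k m \<longrightarrow>
        computes_in C (code (num 6) (code a b)) n m) \<and>
      (computes_in C a n m \<longrightarrow>
        computes_in C (code (num 7) (code a b)) (code n (num 0)) m) \<and>
      (computes_in C (code (num 7) (code a b)) (code n k) l \<and>
       computes_in C b (code n (code k l)) m \<longrightarrow>
        computes_in C (code (num 7) (code a b)) (code n (succ k)) m) \<and>
      (computes_in C a (code n k) (num 0) \<longrightarrow>
        computes_in C (code (num 8) a) (code n k) k) \<and>
      (computes_in C a (code n k) (succ l) \<and>
       computes_in C (code (num 8) a) (code n (succ k)) m \<longrightarrow>
        computes_in C (code (num 8) a) (code n k) m) \<and>
      (computes_in C a n m \<longrightarrow>
        computes_in C (code (num 9) b) (code a n) m))"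

text \<open>\<open>phi x e n m\<close>: the computation \<open>\<phi>\<^sub>e\<^sup>x(n)\<close> converges with value \<open>m\<close>.\<close>

definition phi :: "'v \<Rightarrow> 'v \<Rightarrow> 'v \<Rightarrow> 'v \<Rightarrow> bool" where
  "phi x e n m \<longleftrightarrow> (\<forall>C. phi_closed x C \<longrightarrow> computes_in C e n m)"


section \<open>Turing reducibility, cones, and uniform Turing invariance\<close>

definition le_via :: "'v \<Rightarrow> 'v \<Rightarrow> 'v \<Rightarrow> bool" where
  "le_via x y i \<longleftrightarrow> (\<forall>n. n \<epsilon> omega \<longrightarrow> phi y i n (app x n))"

definition le_T :: "'v \<Rightarrow> 'v \<Rightarrow> bool" where
  "le_T x y \<longleftrightarrow> (\<exists>i. i \<epsilon> omega \<and> le_via x y i)"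

definition equiv_T :: "'v \<Rightarrow> 'v \<Rightarrow> bool" where
  "equiv_T x y \<longleftrightarrow> le_T x y \<and> le_T y x"

definition equiv_via :: "'v \<Rightarrow> 'v \<Rightarrow> 'v \<Rightarrow> 'v \<Rightarrow> bool" where
  "equiv_via x y i j \<longleftrightarrow> le_via y x i \<and> le_via x y j"

definition cone :: "'v \<Rightarrow> 'v" where
  "cone z = coll (\<lambda>x. x \<epsilon> cantor \<and> le_T z x)"

definition on_cone :: "('v \<Rightarrow> bool) \<Rightarrow> bool" where
  "on_cone P \<longleftrightarrow> (\<exists>z. z \<epsilon> cantor \<and> (\<forall>x. x \<epsilon> cone z \<longrightarrow> P x))"

definition TD :: bool where
  "TD \<longleftrightarrow>
    (\<forall>A. (\<forall>x. x \<epsilon> A \<longrightarrow> x \<epsilon> cantor) \<and>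
         (\<forall>x y. x \<epsilon> A \<and> y \<epsilon> cantor \<and> equiv_T x y \<longrightarrow> y \<epsilon> A) \<longrightarrow>
       (\<exists>z. z \<epsilon> cantor \<and> (\<forall>x. x \<epsilon> cone z \<longrightarrow> x \<epsilon> A)) \<or>
       (\<exists>z. z \<epsilon> cantor \<and> (\<forall>x. x \<epsilon> cone z \<longrightarrow> \<not> x \<epsilon> A)))"

text \<open>\<open>UTI f A\<close>: the function \<open>f : A \<rightarrow> 2^\<nat>\<close> with \<open>A \<subseteq> 2^\<nat>\<close> is uniformly Turing invariant.\<close>

definition UTI :: "'v \<Rightarrow> 'v \<Rightarrow> bool" where
  "UTI f A \<longleftrightarrow>
    (\<forall>x. x \<epsilon> A \<longrightarrow> x \<epsilon> cantor) \<and> is_fun f A cantor \<and>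
    (\<exists>u. is_fun u (prod_set omega omega) (prod_set omega omega) \<and>
      (\<forall>x y i j. x \<epsilon> A \<and> y \<epsilon> A \<and> i \<epsilon> omega \<and> j \<epsilon> omega \<and> equiv_via x y i j \<longrightarrow>
        (\<exists>i' j'. app u (opair i j) = opair i' j' \<and> equiv_via (app f x) (app f y) i' j')))"

definition UTI_on_cone :: "'v \<Rightarrow> bool" where
  "UTI_on_cone f \<longleftrightarrow> (\<exists>z. z \<epsilon> cantor \<and> UTI (restr f (cone z)) (cone z))"

end

end

theory Submission
  imports Defs
begin

text \<open>
  The theorem follows from a phenomenon inside a single Turing degree. Let \<open>x \<equiv>\<^sub>T y\<close> lie in the
  cone on which \<open>f\<close> is uniformly invariant, and suppose that \<open>f(x) \<noteq> f(y)\<close>. Then \<open>x \<le>\<^sub>T f(x)\<close>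
  (\<open>local_dichotomy\<close>). For each \<open>n\<close> let \<open>z\<^sub>n\<close> be \<open>x\<close> if \<open>x(n) = 0\<close> and \<open>y\<close> otherwise. A fixed bit
  on which \<open>f(x)\<close> and \<open>f(y)\<close> differ tells from \<open>f(z\<^sub>n)\<close> what \<open>x(n)\<close> is, so it suffices that \<open>f(x)\<close>
  computes \<open>f(z\<^sub>n)\<close> uniformly in \<open>n\<close>. Now \<open>x\<close> and \<open>z\<^sub>n\<close> are equivalent via indices which are
  computable from \<open>n\<close>, but the function \<open>u\<close> which translates these indices into indices for \<open>f(x)\<close>
  and \<open>f(z\<^sub>n)\<close> need not be computable. This is circumvented by walking from \<open>x\<close> to \<open>z\<^sub>n\<close> along
  steps that use only finitely many pairs of indices, so that only finitely many values of \<open>u\<close>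
  matter. Let \<open>mark n t\<close> be the real \<open>t\<close> together with a marker at position \<open>n\<close>. The walk is \<open>x,
  mark 0 x, mark 1 x, \<dots>, mark n x, mark n z\<^sub>n, \<dots>, mark 0 z\<^sub>n, z\<^sub>n\<close>: moving the marker by one does
  not depend on \<open>n\<close>, and neither does the passage from \<open>mark n x\<close> to \<open>mark n z\<^sub>n\<close>, which finds \<open>n\<close>
  by searching for the marker. On the side of \<open>f\<close>, the real \<open>f(x)\<close> iterates the corresponding
  fixed reductions \<open>n\<close> times (\<open>path_up\<close>, \<open>path_down\<close>, \<open>decode_from_values\<close>).

  Globally, Turing determinacy applied to \<open>{x. x \<le>\<^sub>T f(x)}\<close> yields the first alternative or a cone
  on which \<open>x \<le>\<^sub>T f(x)\<close> always fails. On that cone \<open>f\<close> is constant on every degree, so each \<open>{x.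
  f(x)(n) = 0}\<close> is invariant and every bit of \<open>f(x)\<close> is eventually constant. Dependent choice
  selects a cone for every bit, and a countable join of their bases lies in all of them
  (\<open>countable_cones\<close>, \<open>uniform_martin\<close>).

  To iterate reductions one needs relative computation: if \<open>\<phi>\<^sub>c\<^sup>y(n) = l\<close> and \<open>x\<close> computes \<open>y\<close>,
  then \<open>x\<close> computes \<open>l\<close> uniformly in \<open>c\<close>, \<open>n\<close> and a description of \<open>y\<close> from \<open>x\<close>. This is a
  self-interpreter for the numbering (\<open>phi_eval\<close>), in which oracle queries are answered by a
  program.

  All of this takes place in a possibly nonstandard structure. Sets and inductions over \<open>omega\<close>
  are available only for predicates which are first-order definable with parameters, which
  explains the calculus of definability below.
\<close>

section \<open>Definable predicates\<close>

context set_structure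
begin

text \<open>
  An assignment is split into two: the even places hold the variables of a predicate, the odd
  places hold parameters. Infinitely many places remain for parameters, so any two lists of
  parameters can be combined and a fresh place for a bound variable can always be found by
  shifting them.
\<close>

definition merge :: "(nat \<Rightarrow> 'v) \<Rightarrow> (nat \<Rightarrow> 'v) \<Rightarrow> nat \<Rightarrow> 'v" where
  "merge e c i = (if even i then e (i div 2) else c (i div 2))"

primrec rename :: "(nat \<Rightarrow> nat) \<Rightarrow> fm \<Rightarrow> fm" where
  "rename \<rho> (Mem i j) = Mem (\<rho> i) (\<rho> j)"
| "rename \<rho> (Equal i j) = Equal (\<rho> i) (\<rho> j)"
| "rename \<rho> (Neg p) = Neg (rename \<rho> p)"
| "rename \<rho> (Conj p q) = Conj (rename \<rho> p) (rename \<rho> q)"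
| "rename \<rho> (Forall i p) = Forall (\<rho> i) (rename \<rho> p)"

text \<open>
  For an injective renaming no variable is captured, since a quantified variable stays distinct
  from all the others.
\<close>

lemma sat_rename:
  assumes "inj \<rho>" shows "sat (rename \<rho> p) env \<longleftrightarrow> sat p (env \<circ> \<rho>)"
proof (induction p arbitrary: env)
  case (Forall i p)
  have "(env(\<rho> i := a)) \<circ> \<rho> = (env \<circ> \<rho>)(i := a)" for a
    using assms by (auto simp: fun_eq_iff inj_eq)
  then show ?case by (simp only: rename.simps sat.simps Forall.IH)
qed auto

definition definable :: "((nat \<Rightarrow> 'v) \<Rightarrow> bool) \<Rightarrow> bool" where
  "definable P \<longleftrightarrow> (\<exists>\<phi> c. \<forall>e. P e \<longleftrightarrow> sat \<phi> (merge e c))"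

text \<open>
  The value of the term is the variable 0 and the arguments of the term are shifted by one.
  Quantifier rules use the same convention, so that bound variables behave like de Bruijn indices
  and the rules apply by higher-order pattern matching.
\<close>

definition definable_term :: "((nat \<Rightarrow> 'v) \<Rightarrow> 'v) \<Rightarrow> bool" where
  "definable_term t \<longleftrightarrow> definable (\<lambda>e. e 0 = t (\<lambda>i. e (Suc i)))"

lemma definableI: "(\<And>e. P e \<longleftrightarrow> sat \<phi> (merge e c)) \<Longrightarrow> definable P"
  unfolding definable_def by blast

lemma definable_not:
  assumes "definable P" shows "definable (\<lambda>e. \<not> P e)"
proof -
  obtain p c where "\<And>e. P e \<longleftrightarrow> sat p (merge e c)" using assms unfolding definable_def by blast
  then show ?thesis by (intro definableI[where \<phi> = "Neg p" and c = c]) simp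
qed

lemma definable_and:
  assumes "definable P" "definable Q" shows "definable (\<lambda>e. P e \<and> Q e)"
proof -
  obtain p c where p: "\<And>e. P e \<longleftrightarrow> sat p (merge e c)" using assms unfolding definable_def by blast
  obtain q d where q: "\<And>e. Q e \<longleftrightarrow> sat q (merge e d)" using assms unfolding definable_def by blast
  \<comment> \<open>The parameters of the two formulas are interleaved at the places 1 and 3 modulo
    4.\<close>
  define r s :: "nat \<Rightarrow> nat" where "r i = (if even i then i else 2 * i - 1)"
    and "s i = (if even i then i else 2 * i + 1)" for i
  have r: "inj r" and s: "inj s" unfolding r_def s_def inj_def by (auto; presburger)+
  have *: "(merge e (merge c d) \<circ> r) i = merge e c i" "(merge e (merge c d) \<circ> s) i = merge e d i"
    for e i
  proof (atomize(full), cases "even i")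
    case False
    then obtain j where "i = 2 * j + 1" by (blast elim: oddE)
    moreover have "(4 * j + 1) div 2 = 2 * j" "(4 * j + 3) div 2 = 2 * j + 1" for j :: nat
      by presburger+
    ultimately show "(merge e (merge c d) \<circ> r) i = merge e c i \<and>
        (merge e (merge c d) \<circ> s) i = merge e d i"
      by (simp add: merge_def r_def s_def)
  qed (simp add: merge_def r_def s_def)
  then have "merge e (merge c d) \<circ> r = merge e c" "merge e (merge c d) \<circ> s = merge e d" for e
    by blast+
  then show ?thesis
    by (intro definableI[where \<phi> = "Conj (rename r p) (rename s q)" and c = "merge c d"])
      (simp add: sat_rename r s p q)
qed

lemma definable_all:
  assumes "definable (\<lambda>e. Q (\<lambda>i. e (Suc i)) (e 0))" shows "definable (\<lambda>e. \<forall>a. Q e a)"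
proof -
  obtain p c where p: "\<And>e. Q (\<lambda>i. e (Suc i)) (e 0) \<longleftrightarrow> sat p (merge e c)"
    using assms unfolding definable_def by blast
  \<comment> \<open>The bound variable is moved to place 1, the first parameter place; the
    parameters make room.\<close>
  define r :: "nat \<Rightarrow> nat" where "r i = (if i = 0 then 1 else if even i then i - 2 else i + 2)" for i
  have r: "inj r" unfolding r_def inj_def by (auto; presburger)
  have "(merge e (case_nat undefined c))(1 := a) \<circ> r = merge (case_nat a e) c" for e a
  proof
    fix i show "((merge e (case_nat undefined c))(1 := a) \<circ> r) i = merge (case_nat a e) c i"
    proof (cases "even i")
      case True
      then obtain j where "i = 2 * j" by blast
      then show ?thesis by (cases j) (auto simp: merge_def r_def)
    next
      case False
      then obtain j where "i = 2 * j + 1" by (blast elim: oddE)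
      then show ?thesis by (auto simp: merge_def r_def)
    qed
  qed
  moreover have "Q e a \<longleftrightarrow> sat p (merge (case_nat a e) c)" for e a
    using p[of "case_nat a e"] by simp
  ultimately show ?thesis
    by (intro definableI[where \<phi> = "Forall 1 (rename r p)" and c = "case_nat undefined c"])
      (simp add: sat_rename r)
qed

lemma definable_rename:
  assumes "definable P" "inj s" shows "definable (\<lambda>e. P (\<lambda>i. e (s i)))"
proof -
  obtain p c where p: "\<And>e. P e \<longleftrightarrow> sat p (merge e c)" using assms unfolding definable_def by blast
  define r where "r i = (if even i then 2 * s (i div 2) else i)" for i
  have r: "inj r"
  proof (rule injI)
    fix i j assume ij: "r i = r j"
    have "even (r k) \<longleftrightarrow> even k" for k by (simp add: r_def)
    then have "even i \<longleftrightarrow> even j" using ij by metis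
    then show "i = j" using ij injD[OF assms(2), of "i div 2" "j div 2"]
      by (simp add: r_def split: if_splits) (metis dvd_mult_div_cancel)
  qed
  have "merge e c \<circ> r = merge (\<lambda>i. e (s i)) c" for e
    by (auto simp: fun_eq_iff merge_def r_def)
  then show ?thesis
    by (intro definableI[where \<phi> = "rename r p" and c = c]) (simp add: sat_rename r p)
qed

lemma definable_or:
  assumes "definable P" "definable Q" shows "definable (\<lambda>e. P e \<or> Q e)"
proof -
  have "definable (\<lambda>e. \<not> (\<not> P e \<and> \<not> Q e))" by (intro definable_not definable_and assms)
  then show ?thesis by simp
qed

lemma definable_imp:
  assumes "definable P" "definable Q" shows "definable (\<lambda>e. P e \<longrightarrow> Q e)"
proof -
  have "definable (\<lambda>e. \<not> (P e \<and> \<not> Q e))" by (intro definable_not definable_and assms)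
  then show ?thesis by simp
qed

lemma definable_iff:
  assumes "definable P" "definable Q" shows "definable (\<lambda>e. P e \<longleftrightarrow> Q e)"
proof -
  have "definable (\<lambda>e. (P e \<longrightarrow> Q e) \<and> (Q e \<longrightarrow> P e))" by (intro definable_imp definable_and assms)
  moreover have "(\<lambda>e. (P e \<longrightarrow> Q e) \<and> (Q e \<longrightarrow> P e)) = (\<lambda>e. P e \<longleftrightarrow> Q e)" by blast
  ultimately show ?thesis by simp
qed

lemma definable_ex:
  assumes "definable (\<lambda>e. Q (\<lambda>i. e (Suc i)) (e 0))" shows "definable (\<lambda>e. \<exists>a. Q e a)"
proof -
  have "definable (\<lambda>e. \<not> (\<forall>a. \<not> Q e a))" by (intro definable_not definable_all assms)
  then show ?thesis by simp
qed

lemma definable_term_const: "definable_term (\<lambda>e. c)"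
  unfolding definable_term_def
  by (rule definableI[where \<phi> = "Equal 0 1" and c = "\<lambda>_. c"]) (simp add: merge_def)

lemma definable_term_var: "definable_term (\<lambda>e. e i)"
  unfolding definable_term_def
  by (rule definableI[where \<phi> = "Equal 0 (2 * Suc i)"]) (simp add: merge_def)

lemma definable_term_weaken:
  assumes "definable_term t" shows "definable_term (\<lambda>e. t (\<lambda>i. e (Suc i)))"
proof -
  have "inj (case_nat 0 (\<lambda>i. Suc (Suc i)))" by (auto simp: inj_def split: nat.splits)
  from definable_rename[OF assms[unfolded definable_term_def] this] show ?thesis unfolding
      definable_term_def by simp
qed

lemma definable_let:
  assumes "definable_term t" "definable (\<lambda>e. Q (\<lambda>i. e (Suc i)) (e 0))"
  shows "definable (\<lambda>e. Q e (t e))"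
proof -
  have "definable (\<lambda>e. \<exists>a. a = t e \<and> Q e a)"
    by (intro definable_ex definable_and assms(2)) (use assms(1) in \<open>simp add: definable_term_def\<close>)
  then show ?thesis by simp
qed

lemma definable_subst2:
  assumes R: "definable (\<lambda>e. R (e 0) (e 1))" and t: "definable_term t" and s: "definable_term s"
  shows "definable (\<lambda>e. R (t e) (s e))"
proof -
  have "inj (\<lambda>i. if i = 0 then 1 else if i = 1 then 0 else i :: nat)" by (auto simp: inj_def)
  from definable_rename[OF R this] have "definable (\<lambda>e. R (e (Suc 0)) (e 0))" by simp
  then have "definable (\<lambda>e. R (e 0) (s (\<lambda>i. e (Suc i))))" 
    by (intro definable_let[OF definable_term_weaken[OF s], of "\<lambda>e. R (e 0)"])
  then show ?thesis by (rule definable_let[OF t, of "\<lambda>e a. R a (s e)"])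
qed

lemma definable_mem: "definable_term t \<Longrightarrow> definable_term s \<Longrightarrow> definable (\<lambda>e. t e \<epsilon> s e)"
  by (rule definable_subst2) (rule definableI[where \<phi> = "Mem 0 2"], simp add: merge_def)

lemma definable_eq: "definable_term t \<Longrightarrow> definable_term s \<Longrightarrow> definable (\<lambda>e. t e = s e)"
  by (rule definable_subst2) (rule definableI[where \<phi> = "Equal 0 2"], simp add: merge_def)

lemma definable_subst4:
  assumes R: "definable (\<lambda>e. R (e 0) (e 1) (e 2) (e 3))" and "definable_term t" "definable_term s"
      "definable_term u" "definable_term v"
  shows "definable (\<lambda>e. R (t e) (s e) (u e) (v e))"
proof -
  define r where "r i = (if i < 4 then 3 - i else i :: nat)" for i
  have "inj r" unfolding inj_def r_def by (auto split: if_splits)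
  from definable_rename[OF R this]
  have "definable (\<lambda>e. R (e (Suc (Suc (Suc 0)))) (e (Suc (Suc 0))) (e (Suc 0)) (e 0))"
    by (simp add: r_def numeral_eq_Suc)
  note 1 = definable_let[OF definable_term_weaken[OF
      definable_term_weaken[OF definable_term_weaken[OF assms(5)]]],
    of "\<lambda>e a. R (e (Suc (Suc 0))) (e (Suc 0)) (e 0) a", OF this]
  note 2 = definable_let[OF definable_term_weaken[OF definable_term_weaken[OF assms(4)]],
    of "\<lambda>e a. R (e (Suc 0)) (e 0) a (v (\<lambda>i. e (Suc (Suc i))))", OF 1]
  note 3 = definable_let[OF definable_term_weaken[OF assms(3)],
    of "\<lambda>e a. R (e 0) a (u (\<lambda>i. e (Suc i))) (v (\<lambda>i. e (Suc i)))", OF 2]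
  show ?thesis using definable_let[OF assms(2),
    of "\<lambda>e a. R a (s e) (u e) (v e)", OF 3] .
qed

text \<open>
  A definite description that fails to denote has an unspecified value, which no formula
  describes. The notions with suffix \<open>_dfn\<close> replace \<open>app\<close> and \<open>code\<close> by functions that have a
  first-order definition everywhere and agree with them on the intended arguments. Here this is
  the union of all values of \<open>f\<close> at \<open>a\<close>.
\<close>

definition app_dfn :: "'v \<Rightarrow> 'v \<Rightarrow> 'v" where
  "app_dfn f a = coll (\<lambda>z. \<exists>b. opair a b \<epsilon> f \<and> z \<epsilon> b)"

lemmas definable_intros = definable_all definable_ex definable_and definable_or definable_not
    definable_imp definable_iff definable_mem definable_eq
  definable_term_const definable_term_var

end

section \<open>Set theory inside the structure\<close>

context ZF
begin

lemma mem_coll: "\<exists>s. \<forall>x. x \<epsilon> s \<longleftrightarrow> P x \<Longrightarrow> x \<epsilon> coll P \<longleftrightarrow> P x"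
proof -
  assume "\<exists>s. \<forall>x. x \<epsilon> s \<longleftrightarrow> P x"
  then obtain s where s: "\<forall>x. x \<epsilon> s \<longleftrightarrow> P x" by blast
  have "coll P = s" unfolding coll_def
  proof (rule the_equality)
    show "t = s" if "\<forall>x. x \<epsilon> t \<longleftrightarrow> P x" for t by (rule extensionality) (simp add: s that)
  qed (rule s)
  then show ?thesis using s by simp
qed

lemma definable_term_coll:
  assumes "definable (\<lambda>e. P (\<lambda>i. e (Suc i)) (e 0))" and "\<And>e. \<exists>s. \<forall>x. x \<epsilon> s \<longleftrightarrow> P e x"
  shows "definable_term (\<lambda>e. coll (P e))"
proof -
  have "z = coll (P e) \<longleftrightarrow> (\<forall>x. x \<epsilon> z \<longleftrightarrow> P e x)" for z e
    using mem_coll[OF assms(2)] extensionality[of z "coll (P e)"] by auto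
  moreover
  have "inj (case_nat 0 (\<lambda>i. Suc (Suc i)))" by (auto simp: inj_def split: nat.splits)
  from definable_rename[OF assms(1) this]
  have "definable (\<lambda>e. P (\<lambda>i. e (Suc (Suc i))) (e 0))" by simp
  ultimately show ?thesis unfolding definable_term_def by (auto intro!: definable_intros)
qed

lemma Separation:
  assumes "definable (\<lambda>e. P (e 0))" shows "\<exists>y. \<forall>z. z \<epsilon> y \<longleftrightarrow> z \<epsilon> x \<and> P z"
proof -
  obtain p c where p: "\<And>e. P (e 0) \<longleftrightarrow> sat p (merge e c)" using assms unfolding definable_def by blast
  have "(merge (\<lambda>_. undefined) c)(0 := z) = merge (case_nat z (\<lambda>_. undefined)) c" for z
    by (auto simp: fun_eq_iff merge_def elim!: evenE split: nat.splits)
  then show ?thesis using separation[of x p "merge (\<lambda>_. undefined) c"] p[of "case_nat _ _"] by simp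
qed

lemma bounded_coll:
  assumes "definable (\<lambda>e. P (e 0))" "\<And>z. P z \<Longrightarrow> z \<epsilon> x" shows "\<exists>s. \<forall>z. z \<epsilon> s \<longleftrightarrow> P z"
  using Separation[OF assms(1), of x] assms(2) by blast

lemma mem_upair [simp]: "z \<epsilon> upair a b \<longleftrightarrow> z = a \<or> z = b"
  unfolding upair_def by (rule mem_coll) (rule pairing)

lemma opair_inject [simp]: "opair a b = opair c d \<longleftrightarrow> a = c \<and> b = d"
  unfolding opair_def by (metis mem_upair)

lemma definable_upair:
  assumes "definable_term t" "definable_term s" shows "definable_term (\<lambda>e. upair (t e) (s e))"
  unfolding upair_def
  by (rule definable_term_coll, intro definable_intros assms[THEN definable_term_weaken])
      (rule pairing)

lemma definable_opair: "definable_term t \<Longrightarrow> definable_term s \<Longrightarrow> definable_term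
    (\<lambda>e. opair (t e) (s e))"
  unfolding opair_def by (intro definable_upair)

lemma union2: "\<exists>u. \<forall>z. z \<epsilon> u \<longleftrightarrow> z \<epsilon> a \<or> z \<epsilon> b"
  using union[of "upair a b"] by (metis mem_upair)

lemma prod_exists: "\<exists>s. \<forall>p. p \<epsilon> s \<longleftrightarrow> (\<exists>a b. a \<epsilon> A \<and> b \<epsilon> B \<and> p = opair a b)"
proof -
  obtain u where u: "\<forall>z. z \<epsilon> u \<longleftrightarrow> z \<epsilon> A \<or> z \<epsilon> B" using union2 by blast
  obtain v where v: "\<forall>y. y \<epsilon> v \<longleftrightarrow> (\<forall>z. z \<epsilon> y \<longrightarrow> z \<epsilon> u)" using power_set by blast
  obtain w where w: "\<forall>y. y \<epsilon> w \<longleftrightarrow> (\<forall>z. z \<epsilon> y \<longrightarrow> z \<epsilon> v)" using power_set by blast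
  have D: "definable (\<lambda>e. \<exists>a b. a \<epsilon> A \<and> b \<epsilon> B \<and> e 0 = opair a b)"
    by (intro definable_intros definable_opair)
  show ?thesis
    by (rule bounded_coll[where x = w, OF D]) (auto simp: opair_def u v w)
qed

lemma mem_prod_set: "p \<epsilon> prod_set A B \<longleftrightarrow> (\<exists>a b. a \<epsilon> A \<and> b \<epsilon> B \<and> p = opair a b)"
  unfolding prod_set_def by (rule mem_coll) (rule prod_exists)

lemma opair_mem_prod_set [simp]: "opair a b \<epsilon> prod_set A B \<longleftrightarrow> a \<epsilon> A \<and> b \<epsilon> B"
  by (auto simp: mem_prod_set)

lemma succ_exists: "\<exists>s. \<forall>x. x \<epsilon> s \<longleftrightarrow> x \<epsilon> a \<or> x = a"
  using union2[of a "upair a a"] by simp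

lemma mem_succ [simp]: "x \<epsilon> succ a \<longleftrightarrow> x \<epsilon> a \<or> x = a"
  unfolding succ_def by (rule mem_coll) (rule succ_exists)

lemma definable_succ:
  assumes "definable_term t" shows "definable_term (\<lambda>e. succ (t e))"
  unfolding succ_def
  by (rule definable_term_coll, intro definable_intros assms[THEN definable_term_weaken])
      (rule succ_exists)

lemma not_mem_0 [simp]: "\<not> x \<epsilon> num 0"
proof -
  have "\<exists>s. \<forall>x. x \<epsilon> s \<longleftrightarrow> False" using infinity by blast
  then show ?thesis by (simp add: mem_coll)
qed

text \<open>
  Foundation enters through this lemma alone; it makes the successor injective.
\<close>

lemma not_mem_both: "\<not> (a \<epsilon> b \<and> b \<epsilon> a)"
  using foundation[of "upair a b"] by (metis mem_upair)

lemma not_mem_self [simp]: "\<not> a \<epsilon> a"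
  using not_mem_both by blast

lemma succ_inject [simp]: "succ a = succ b \<longleftrightarrow> a = b"
  by (metis mem_succ not_mem_both)

lemma succ_neq_0 [simp]: "succ a \<noteq> num 0" "num 0 \<noteq> succ a"
  by (metis mem_succ not_mem_0)+

declare num.simps(1) [simp del]

lemma mem_omega: "n \<epsilon> omega \<longleftrightarrow> (\<forall>I. num 0 \<epsilon> I \<and> (\<forall>x. x \<epsilon> I \<longrightarrow> succ x \<epsilon> I) \<longrightarrow> n \<epsilon> I)"
proof -
  obtain I e where I: "e \<epsilon> I" "\<forall>x. \<not> x \<epsilon> e"
    "\<forall>x. x \<epsilon> I \<longrightarrow> (\<exists>y. y \<epsilon> I \<and> (\<forall>z. z \<epsilon> y \<longleftrightarrow> z \<epsilon> x \<or> z = x))"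
    using infinity by blast
  have 0: "num 0 \<epsilon> I" using extensionality[of e "num 0"] I by simp
  have S: "succ x \<epsilon> I" if x: "x \<epsilon> I" for x
  proof -
    obtain y where y: "y \<epsilon> I" "\<forall>z. z \<epsilon> y \<longleftrightarrow> z \<epsilon> x \<or> z = x" using I x by blast
    have "y = succ x" by (rule extensionality) (simp add: y)
    then show ?thesis using y by simp
  qed
  show ?thesis unfolding omega_def
    by (rule mem_coll, rule bounded_coll[where x = I])
      (use 0 S in \<open>auto intro!: definable_intros definable_succ\<close>)
qed

lemma omega_0 [simp]: "num 0 \<epsilon> omega"
  by (simp add: mem_omega)

lemma omega_succ [simp]: "n \<epsilon> omega \<Longrightarrow> succ n \<epsilon> omega"
  by (simp add: mem_omega)

lemma omega_num [simp]: "num k \<epsilon> omega"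
  by (induction k) simp_all

text \<open>
  Induction in the structure is restricted to definable \<open>P\<close>, since \<open>omega\<close> may have nonstandard
  elements. It is the leastness of \<open>omega\<close> applied to the subset cut out by \<open>P\<close>.
\<close>

lemma omega_induct:
  assumes "n \<epsilon> omega" and D: "definable (\<lambda>e. P (e 0))" and 0: "P (num 0)"
    and S: "\<And>n. n \<epsilon> omega \<Longrightarrow> P n \<Longrightarrow> P (succ n)"
  shows "P n"
proof -
  obtain I where I: "\<forall>z. z \<epsilon> I \<longleftrightarrow> z \<epsilon> omega \<and> P z" using Separation[OF D] by blast
  then have "num 0 \<epsilon> I" "\<forall>x. x \<epsilon> I \<longrightarrow> succ x \<epsilon> I" using 0 S by auto
  then have "n \<epsilon> I" using assms(1) mem_omega[of n] by blast
  then show ?thesis using I by blast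
qed

lemma omega_cases:
  assumes "n \<epsilon> omega"
  obtains "n = num 0" | m where "m \<epsilon> omega" "n = succ m"
proof -
  have "n = num 0 \<or> (\<exists>m. m \<epsilon> omega \<and> n = succ m)"
    by (rule omega_induct[OF assms]) (auto intro!: definable_intros definable_succ)
  then show ?thesis using that by blast
qed

lemma omega_trans:
  assumes "n \<epsilon> omega" shows "\<forall>x y. x \<epsilon> y \<and> y \<epsilon> n \<longrightarrow> x \<epsilon> n"
  by (rule omega_induct[OF assms]) (auto intro!: definable_intros)

lemma succ_mem_succ: "n \<epsilon> omega \<Longrightarrow> succ k \<epsilon> succ n \<Longrightarrow> k \<epsilon> n"
  using omega_trans[of n] by (metis mem_succ)

lemma zero_mem_succ:
  assumes "n \<epsilon> omega" shows "num 0 \<epsilon> succ n"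
  by (rule omega_induct[OF assms]) (auto intro!: definable_intros definable_succ)

lemma mem_num_2: "b \<epsilon> num 2 \<longleftrightarrow> b = num 0 \<or> b = num 1"
  by (auto simp: numeral_2_eq_2)

lemma num_1: "num 1 = succ (num 0)" by simp

lemma is_fun_mem_iff:
  assumes "is_fun f A B" "a \<epsilon> A"
  shows "opair a b \<epsilon> f \<longleftrightarrow> b = app f a"
proof -
  have "\<exists>!b. opair a b \<epsilon> f" using assms unfolding is_fun_def by blast
  then show ?thesis unfolding app_def by (metis theI')
qed

lemma is_fun_app [simp]: "is_fun f A B \<Longrightarrow> a \<epsilon> A \<Longrightarrow> app f a \<epsilon> B"
  using is_fun_mem_iff[of f A B a "app f a"] unfolding is_fun_def by fastforce

lemma app_dfn_exists: "\<exists>s. \<forall>z. z \<epsilon> s \<longleftrightarrow> (\<exists>b. opair a b \<epsilon> f \<and> z \<epsilon> b)"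
proof -
  obtain u where u: "\<forall>z. z \<epsilon> u \<longleftrightarrow> (\<exists>y. y \<epsilon> f \<and> z \<epsilon> y)" using union by blast
  obtain v where v: "\<forall>z. z \<epsilon> v \<longleftrightarrow> (\<exists>y. y \<epsilon> u \<and> z \<epsilon> y)" using union by blast
  obtain w where w: "\<forall>z. z \<epsilon> w \<longleftrightarrow> (\<exists>y. y \<epsilon> v \<and> z \<epsilon> y)" using union by blast
  have D: "definable (\<lambda>e. \<exists>b. opair a b \<epsilon> f \<and> e 0 \<epsilon> b)" by (intro definable_intros definable_opair)
  have b: "b \<epsilon> v" if "opair a b \<epsilon> f" for b
  proof -
    have "upair a b \<epsilon> u" using that u by (auto simp: opair_def)
    then show ?thesis using v by auto
  qed
  show ?thesis by (rule bounded_coll[where x = w, OF D]) (use b w in blast)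
qed

lemma definable_app:
  assumes "definable_term t" "definable_term s" shows "definable_term (\<lambda>e. app_dfn (t e) (s e))"
  unfolding app_dfn_def
  by (rule definable_term_coll, intro definable_intros definable_opair
      assms[THEN definable_term_weaken]
      assms[THEN definable_term_weaken, THEN definable_term_weaken]) (rule app_dfn_exists)

lemma app_dfn_eq: "is_fun f A B \<Longrightarrow> a \<epsilon> A \<Longrightarrow> app_dfn f a = app f a"
  unfolding app_dfn_def
  by (rule extensionality, unfold mem_coll[OF app_dfn_exists]) (simp add: is_fun_mem_iff)

lemmas definable_intros_set = definable_intros definable_opair definable_upair definable_succ
    definable_app

lemma mem_cantor: "x \<epsilon> cantor \<longleftrightarrow> is_fun x omega (num 2)"
proof -
  obtain w where w: "\<forall>y. y \<epsilon> w \<longleftrightarrow> (\<forall>z. z \<epsilon> y \<longrightarrow> z \<epsilon> prod_set omega (num 2))"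
    using power_set by blast
  have "definable (\<lambda>e. is_fun (e 0) omega (num 2))"
    unfolding is_fun_def Ex1_def by (intro definable_intros_set)
  moreover have "y \<epsilon> w" if "is_fun y omega (num 2)" for y
    using conjunct1[OF that[unfolded is_fun_def]] w by (simp add: mem_prod_set)
  ultimately show ?thesis unfolding cantor_def by (intro mem_coll bounded_coll)
qed

lemma cantor_bit: "x \<epsilon> cantor \<Longrightarrow> n \<epsilon> omega \<Longrightarrow> app x n = num 0 \<or> app x n = num 1"
  using is_fun_app[of x omega "num 2" n] by (simp add: mem_cantor mem_num_2 del: is_fun_app)

lemma cantor_app_omega [simp]: "x \<epsilon> cantor \<Longrightarrow> n \<epsilon> omega \<Longrightarrow> app x n \<epsilon> omega"
  using cantor_bit by fastforce

lemma app_dfn_cantor: "x \<epsilon> cantor \<Longrightarrow> n \<epsilon> omega \<Longrightarrow> app_dfn x n = app x n"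
  using app_dfn_eq mem_cantor by blast

lemma cantor_ext:
  assumes "x \<epsilon> cantor" "y \<epsilon> cantor" "\<And>n. n \<epsilon> omega \<Longrightarrow> app x n = app y n"
  shows "x = y"
proof -
  have "p \<epsilon> x \<longleftrightarrow> (\<exists>n. n \<epsilon> omega \<and> p = opair n (app x n))" if "x \<epsilon> cantor" for x p
  proof -
    from that have x: "is_fun x omega (num 2)" by (simp add: mem_cantor)
    show ?thesis
      using conjunct1[OF x[unfolded is_fun_def], rule_format, of p] is_fun_mem_iff[OF x] by metis
  qed
  then show ?thesis using assms by (intro extensionality) auto
qed

lemma real_exists:
  assumes "definable (\<lambda>e. P (e 0))"
  shows "\<exists>r. r \<epsilon> cantor \<and> (\<forall>n. n \<epsilon> omega \<longrightarrow> (app r n = (if P n then num 1 else num 0)))"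
proof -
  define Q where "Q p \<longleftrightarrow> (\<exists>n b. p = opair n b \<and> n \<epsilon> omega \<and> (P n \<and> b = num 1 \<or> \<not> P n \<and> b = num 0))"
    for p
  have P: "definable (\<lambda>e. P (e (Suc 0)))"
    using definable_let[OF definable_term_var[of "Suc 0"], of "\<lambda>_. P"] assms by simp
  have "definable (\<lambda>e. Q (e 0))"
    unfolding Q_def by (intro definable_intros_set P)
  moreover have "z \<epsilon> prod_set omega (num 2)" if "Q z" for z
    using that unfolding Q_def by (auto simp: mem_num_2)
  ultimately obtain r where r: "\<And>z. z \<epsilon> r \<longleftrightarrow> Q z"
    using bounded_coll[of Q "prod_set omega (num 2)"] by blast
  have "is_fun r omega (num 2)" unfolding is_fun_def r Q_def by (auto simp: mem_num_2)
  moreover then have "app r n = (if P n then num 1 else num 0)" if "n \<epsilon> omega" for n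
    using that is_fun_mem_iff[of r omega "num 2" n "(if P n then num 1 else num 0)"] r
    by (auto simp: Q_def)
  ultimately show ?thesis using mem_cantor by blast
qed

section \<open>The pairing function\<close>

text \<open>
  The intersection of all closed sets, as a relation. That it is the graph of a bijection is shown
  by induction along the enumeration.
\<close>

definition code_rel :: "'a \<Rightarrow> 'a \<Rightarrow> 'a \<Rightarrow> bool" where
  "code_rel a b c \<longleftrightarrow> (\<forall>P. code_closed P \<longrightarrow> opair a (opair b c) \<epsilon> P)"

definition omega3 :: 'a where "omega3 = prod_set omega (prod_set omega omega)"

lemma mem_omega3 [simp]: "opair a (opair b c) \<epsilon> omega3 \<longleftrightarrow> a \<epsilon> omega \<and> b \<epsilon> omega \<and> c \<epsilon> omega"
  unfolding omega3_def by simp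

lemma definable_swap: "definable (\<lambda>e. R (e 0) (e 1)) \<Longrightarrow> definable (\<lambda>e. R (e (Suc 0)) (e 0))"
  by (rule definable_subst2[of R, OF _ definable_term_var definable_term_var])

lemma pairs_exist:
  assumes "definable (\<lambda>e. R (e 0) (e 1))"
  obtains s where "\<And>a b. opair a b \<epsilon> s \<longleftrightarrow> a \<epsilon> A \<and> b \<epsilon> B \<and> R a b"
    "\<And>p. p \<epsilon> s \<Longrightarrow> p \<epsilon> prod_set A B"
proof -
  have "definable (\<lambda>e. \<exists>a b. e 0 = opair a b \<and> R a b)"
    by (intro definable_intros_set definable_swap[OF assms])
  from Separation[OF this, of "prod_set A B"] obtain s where
    s: "\<forall>z. z \<epsilon> s \<longleftrightarrow> z \<epsilon> prod_set A B \<and> (\<exists>a b. z = opair a b \<and> R a b)" by blast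
  show thesis by (rule that[of s]) (simp_all add: s)
qed

lemma triples_exist:
  assumes "definable (\<lambda>e. R (e 0) (e 1) (e 2))"
  obtains s where "\<And>a b c. opair a (opair b c) \<epsilon> s \<longleftrightarrow>
    a \<epsilon> omega \<and> b \<epsilon> omega \<and> c \<epsilon> omega \<and> R a b c"
proof -
  have "definable (\<lambda>e. R (e (Suc (Suc 0))) (e (Suc 0)) (e 0))"
    by (rule definable_subst4[of "\<lambda>a b c d. R a b c", OF assms definable_term_var
        definable_term_var definable_term_var definable_term_var])
  then have "definable (\<lambda>e. \<exists>a b c. e 0 = opair a (opair b c) \<and> R a b c)"
    by (intro definable_intros_set)
  from Separation[OF this, of omega3] obtain s where
    s: "\<forall>z. z \<epsilon> s \<longleftrightarrow> z \<epsilon> omega3 \<and> (\<exists>a b c. z = opair a (opair b c) \<and> R a b c)" by blast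
  show thesis by (rule that[of s]) (simp add: s)
qed

lemma code_rel_omega:
  assumes "code_rel a b c" shows "a \<epsilon> omega" "b \<epsilon> omega" "c \<epsilon> omega"
proof -
  have "code_closed omega3" unfolding code_closed_def by auto
  then have "opair a (opair b c) \<epsilon> omega3" using assms code_rel_def by blast
  then show "a \<epsilon> omega" "b \<epsilon> omega" "c \<epsilon> omega" by auto
qed

lemma code_rel_0: "code_rel (num 0) (num 0) (num 0)"
  unfolding code_rel_def code_closed_def by blast

lemma code_rel_diag: "code_rel a (succ b) c \<Longrightarrow> b \<epsilon> omega \<Longrightarrow> code_rel (succ a) b (succ c)"
  using code_rel_omega[of a "succ b" c] unfolding code_rel_def[of "succ a"]
  by (metis code_rel_def code_closed_def)

lemma code_rel_jump: "code_rel a (num 0) c \<Longrightarrow> code_rel (num 0) (succ a) (succ c)"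
  using code_rel_omega[of a "num 0" c] unfolding code_rel_def[of "num 0" "succ a"]
  by (metis code_rel_def code_closed_def)

text \<open>
  Inversion: the triples which some rule produces, its premise (if any) being in the relation,
  already form a closed set.
\<close>

lemma code_rel_cases:
  assumes "code_rel a b c"
  obtains "a = num 0" "b = num 0" "c = num 0"
  | a' c' where "a = succ a'" "c = succ c'" "code_rel a' (succ b) c'"
  | a' c' where "a = num 0" "b = succ a'" "c = succ c'" "code_rel a' (num 0) c'"
proof -
  define R where "R a b c \<longleftrightarrow> code_rel a b c \<and> (a = num 0 \<and> b = num 0 \<and> c = num 0 \<or>
    (\<exists>a' c'. a = succ a' \<and> c = succ c' \<and> code_rel a' (succ b) c') \<or>
    (\<exists>a' c'. a = num 0 \<and> b = succ a' \<and> c = succ c' \<and> code_rel a' (num 0) c'))" for a b c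
  have "definable (\<lambda>e. R (e 0) (e 1) (e 2))"
    unfolding R_def code_rel_def code_closed_def by (intro definable_intros_set)
  from triples_exist[OF this] obtain s where s: "\<And>a b c. opair a (opair b c) \<epsilon> s \<longleftrightarrow>
    a \<epsilon> omega \<and> b \<epsilon> omega \<and> c \<epsilon> omega \<and> R a b c" by blast
  have "code_closed s"
    unfolding code_closed_def s R_def using code_rel_0 code_rel_diag code_rel_jump by (auto 4 0)
  then have "R a b c" using assms s unfolding code_rel_def by blast
  then show thesis using that unfolding R_def by blast
qed

lemma code_rel_zero: "code_rel a b (num 0) \<Longrightarrow> a = num 0 \<and> b = num 0"
  by (erule code_rel_cases) auto

lemma code_rel_zero_zero: "code_rel (num 0) (num 0) d \<Longrightarrow> d = num 0"
  by (erule code_rel_cases) auto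

lemma code_rel_succ_left: "code_rel (succ a) b d \<Longrightarrow> \<exists>d'. d = succ d' \<and> code_rel a (succ b) d'"
  by (erule code_rel_cases) auto

lemma code_rel_succ_right: "code_rel (num 0) (succ a) d \<Longrightarrow> \<exists>d'. d = succ d' \<and> code_rel a (num 0) d'"
  by (erule code_rel_cases) auto

lemma code_rel_succ: "code_rel a b (succ n) \<Longrightarrow> (\<exists>a'. a = succ a' \<and> code_rel a' (succ b) n) \<or>
    (\<exists>a'. a = num 0 \<and> b = succ a' \<and> code_rel a' (num 0) n)"
  by (erule code_rel_cases) auto

text \<open>
  The enumeration runs through the diagonal that starts at \<open>(0, b)\<close> and ends at \<open>(b, 0)\<close>.
  Quantifying over \<open>X\<close> avoids addition: removing the first point of the diagonal and shifting the
  first coordinate turns it into the diagonal that starts at \<open>(0, b - 1)\<close>.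
\<close>

lemma diagonal:
  assumes "b \<epsilon> omega"
  shows "\<forall>X. (\<forall>a c. a \<epsilon> omega \<and> c \<epsilon> omega \<and> opair a (succ c) \<epsilon> X \<longrightarrow> opair (succ a) c \<epsilon> X) \<and>
    opair (num 0) b \<epsilon> X \<longrightarrow> opair b (num 0) \<epsilon> X"
proof (rule omega_induct[OF assms], intro definable_intros_set, blast, intro allI impI, elim conjE)
  fix b X
  assume b: "b \<epsilon> omega" and IH: "\<forall>X. (\<forall>a c. a \<epsilon> omega \<and> c \<epsilon> omega \<and> opair a (succ c) \<epsilon> X \<longrightarrow>
      opair (succ a) c \<epsilon> X) \<and> opair (num 0) b \<epsilon> X \<longrightarrow> opair b (num 0) \<epsilon> X"
    and X: "\<forall>a c. a \<epsilon> omega \<and> c \<epsilon> omega \<and> opair a (succ c) \<epsilon> X \<longrightarrow> opair (succ a) c \<epsilon> X"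
    "opair (num 0) (succ b) \<epsilon> X"
  have "definable (\<lambda>e. opair (succ (e 0)) (e 1) \<epsilon> X)" by (intro definable_intros_set)
  from pairs_exist[OF this, of omega omega] obtain Y where
    Y: "\<And>a c. opair a c \<epsilon> Y \<longleftrightarrow> a \<epsilon> omega \<and> c \<epsilon> omega \<and> opair (succ a) c \<epsilon> X" by metis
  have "opair b (num 0) \<epsilon> Y"
    by (rule IH[rule_format]) (use X Y b in auto)
  then show "opair (succ b) (num 0) \<epsilon> X" using Y by blast
qed

lemma code_rel_total:
  assumes "a \<epsilon> omega" "b \<epsilon> omega" shows "\<exists>c. code_rel a b c"
proof -
  have "definable (\<lambda>e. \<exists>c. code_rel (e 0) (e 1) c)"
    unfolding code_rel_def code_closed_def by (intro definable_intros_set)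
  from pairs_exist[OF this, of omega omega] obtain T where
    "\<And>a b. opair a b \<epsilon> T \<longleftrightarrow> a \<epsilon> omega \<and> b \<epsilon> omega \<and> (\<exists>c. code_rel a b c)" by metis
  then have T: "\<And>a b. opair a b \<epsilon> T \<longleftrightarrow> (\<exists>c. code_rel a b c)" using code_rel_omega by blast
  have 0: "opair (num 0) b \<epsilon> T" if "b \<epsilon> omega" for b
  proof (rule omega_induct[OF that])
    show "opair (num 0) (num 0) \<epsilon> T" using code_rel_0 T by blast
    fix n assume n: "n \<epsilon> omega" "opair (num 0) n \<epsilon> T"
    have "opair n (num 0) \<epsilon> T"
      using n T code_rel_diag by (intro diagonal[OF n(1), rule_format]) blast
    then show "opair (num 0) (succ n) \<epsilon> T" using T code_rel_jump by blast
  qed (intro definable_intros_set)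
  have "\<forall>b. b \<epsilon> omega \<longrightarrow> opair a b \<epsilon> T"
  proof (rule omega_induct[OF assms(1)])
    fix n assume "\<forall>b. b \<epsilon> omega \<longrightarrow> opair n b \<epsilon> T"
    then show "\<forall>b. b \<epsilon> omega \<longrightarrow> opair (succ n) b \<epsilon> T"
      using T code_rel_diag omega_succ by meson
  qed (intro definable_intros_set, use 0 in blast)
  then show ?thesis using assms T by blast
qed

lemma code_rel_functional:
  assumes "code_rel a b c" "code_rel a b d" shows "c = d"
proof -
  have "\<forall>a b d. code_rel a b c \<and> code_rel a b d \<longrightarrow> c = d"
  proof (rule omega_induct[OF code_rel_omega(3)[OF assms(1)]])
    show "definable (\<lambda>e. \<forall>a b d. code_rel a b (e 0) \<and> code_rel a b d \<longrightarrow> e 0 = d)"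
      unfolding code_rel_def code_closed_def by (intro definable_intros_set)
  next
    show "\<forall>a b d. code_rel a b (num 0) \<and> code_rel a b d \<longrightarrow> num 0 = d"
      using code_rel_zero code_rel_zero_zero by blast
  next
    fix n assume IH: "\<forall>a b d. code_rel a b n \<and> code_rel a b d \<longrightarrow> n = d"
    have "succ n = d" if n: "code_rel a b (succ n)" and d: "code_rel a b d" for a b d
    proof -
      from code_rel_succ[OF n] consider a' where "a = succ a'" "code_rel a' (succ b) n"
        | a' where "a = num 0" "b = succ a'" "code_rel a' (num 0) n" by blast
      then show ?thesis
      proof cases
        case 1
        then obtain d' where "d = succ d'" "code_rel a' (succ b) d'" using code_rel_succ_left d by
            blast
        then show ?thesis using IH 1 by blast
      next
        case 2
        then obtain d' where "d = succ d'" "code_rel a' (num 0) d'" using code_rel_succ_right d by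
            blast
        then show ?thesis using IH 2 by blast
      qed
    qed
    then show "\<forall>a b d. code_rel a b (succ n) \<and> code_rel a b d \<longrightarrow> succ n = d" by blast
  qed
  then show ?thesis using assms by blast
qed

lemma code_rel_injective:
  assumes "code_rel a b c" "code_rel a' b' c" shows "a = a' \<and> b = b'"
proof -
  have "\<forall>a b a' b'. code_rel a b c \<and> code_rel a' b' c \<longrightarrow> a = a' \<and> b = b'"
  proof (rule omega_induct[OF code_rel_omega(3)[OF assms(1)]])
    show "definable (\<lambda>e. \<forall>a b a' b'. code_rel a b (e 0) \<and> code_rel a' b' (e 0) \<longrightarrow> a = a' \<and> b = b')"
      unfolding code_rel_def code_closed_def by (intro definable_intros_set)
  next
    show "\<forall>a b a' b'. code_rel a b (num 0) \<and> code_rel a' b' (num 0) \<longrightarrow> a = a' \<and> b = b'"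
      using code_rel_zero by blast
  next
    fix n assume IH: "\<forall>a b a' b'. code_rel a b n \<and> code_rel a' b' n \<longrightarrow> a = a' \<and> b = b'"
    have "a = a' \<and> b = b'" if n: "code_rel a b (succ n)" "code_rel a' b' (succ n)" for a b a' b'
      using code_rel_succ[OF n(1)] code_rel_succ[OF n(2)]
      by (elim disjE exE conjE) (metis IH succ_inject succ_neq_0(1))+
    then show "\<forall>a b a' b'. code_rel a b (succ n) \<and> code_rel a' b' (succ n) \<longrightarrow> a = a' \<and> b = b'" by
        blast
  qed
  then show ?thesis using assms by blast
qed

lemma code_rel_surj:
  assumes "c \<epsilon> omega" shows "\<exists>a b. code_rel a b c"
proof (rule omega_induct[OF assms])
  show "definable (\<lambda>e. \<exists>a b. code_rel a b (e 0))"
    unfolding code_rel_def code_closed_def by (intro definable_intros_set)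
  show "\<exists>a b. code_rel a b (num 0)" using code_rel_0 by blast
  fix n assume "\<exists>a b. code_rel a b n"
  then obtain a b where ab: "code_rel a b n" by blast
  from code_rel_omega(2)[OF ab] show "\<exists>a b. code_rel a b (succ n)"
    by (cases rule: omega_cases) (use ab code_rel_jump code_rel_diag in blast)+
qed

lemma code_rel_iff: "a \<epsilon> omega \<Longrightarrow> b \<epsilon> omega \<Longrightarrow> code_rel a b c \<longleftrightarrow> c = code a b"
  unfolding code_def code_rel_def[symmetric] using code_rel_total code_rel_functional by
      (metis theI)

lemma code_omega [simp]: "a \<epsilon> omega \<Longrightarrow> b \<epsilon> omega \<Longrightarrow> code a b \<epsilon> omega"
  using code_rel_iff code_rel_omega by blast

lemma code_inject [simp]:
  "a \<epsilon> omega \<Longrightarrow> b \<epsilon> omega \<Longrightarrow> a' \<epsilon> omega \<Longrightarrow> b' \<epsilon> omega \<Longrightarrow>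
    code a b = code a' b' \<longleftrightarrow> a = a' \<and> b = b'"
  using code_rel_iff code_rel_injective by metis

lemma code_cases:
  assumes "c \<epsilon> omega" obtains a b where "a \<epsilon> omega" "b \<epsilon> omega" "c = code a b"
  using code_rel_surj[OF assms] code_rel_iff code_rel_omega by metis

definition code_graph :: 'a where
  "code_graph = (SOME g. is_fun g (prod_set omega omega) omega \<and>
    (\<forall>a b. a \<epsilon> omega \<and> b \<epsilon> omega \<longrightarrow> app g (opair a b) = code a b))"

definition code_dfn :: "'a \<Rightarrow> 'a \<Rightarrow> 'a" where
  "code_dfn a b = app_dfn code_graph (opair a b)"

lemma code_dfn_eq:
  assumes "a \<epsilon> omega" "b \<epsilon> omega" shows "code_dfn a b = code a b"
proof -
  have "definable (\<lambda>e. \<exists>a b c. e 0 = opair (opair a b) c \<and> code_rel a b c)"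
    unfolding code_rel_def code_closed_def by (intro definable_intros_set)
  moreover have "z \<epsilon> prod_set (prod_set omega omega) omega"
    if "\<exists>a b c. z = opair (opair a b) c \<and> code_rel a b c" for z
    using that code_rel_omega by auto
  ultimately have "\<exists>g. \<forall>p. p \<epsilon> g \<longleftrightarrow> (\<exists>a b c. p = opair (opair a b) c \<and> code_rel a b c)"
    by (rule bounded_coll)
  then obtain g where
    g: "\<And>p. p \<epsilon> g \<longleftrightarrow> (\<exists>a b c. p = opair (opair a b) c \<and> code_rel a b c)" by blast
  have g': "opair (opair a b) c \<epsilon> g \<longleftrightarrow> c = code a b" if "a \<epsilon> omega" "b \<epsilon> omega" for a b c
    using that by (simp add: g code_rel_iff)
  have "is_fun g (prod_set omega omega) omega"
    unfolding is_fun_def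
  proof (intro conjI allI impI)
    fix p assume "p \<epsilon> g"
    then obtain a b c where "p = opair (opair a b) c" "code_rel a b c" using g by blast
    then show "\<exists>d c. d \<epsilon> prod_set omega omega \<and> c \<epsilon> omega \<and> p = opair d c"
      using code_rel_omega by (metis opair_mem_prod_set)
  next
    fix d assume "d \<epsilon> prod_set omega omega"
    then obtain a b where "d = opair a b" "a \<epsilon> omega" "b \<epsilon> omega" using mem_prod_set by blast
    then show "\<exists>!c. opair d c \<epsilon> g" using g' by simp
  qed
  moreover from is_fun_mem_iff[OF this] have "app g (opair a b) = code a b"
    if "a \<epsilon> omega" "b \<epsilon> omega" for a b
    using that g' by (metis opair_mem_prod_set)
  ultimately have "\<exists>g. is_fun g (prod_set omega omega) omega \<and>
    (\<forall>a b. a \<epsilon> omega \<and> b \<epsilon> omega \<longrightarrow> app g (opair a b) = code a b)" by blast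
  from someI_ex[OF this] have "is_fun code_graph (prod_set omega omega) omega"
    "app code_graph (opair a b) = code a b"
    unfolding code_graph_def[symmetric] using assms by blast+
  then show ?thesis using assms app_dfn_eq[of code_graph] unfolding code_dfn_def by simp
qed

lemma definable_code: "definable_term t \<Longrightarrow> definable_term s \<Longrightarrow> definable_term
    (\<lambda>e. code_dfn (t e) (s e))"
  unfolding code_dfn_def by (intro definable_intros_set)

section \<open>Programs\<close>

text \<open>
  The closure conditions of \<open>phi_closed\<close>, written with \<open>app_dfn\<close> and \<open>code_dfn\<close> so that \<open>phi\<close>
  becomes definable.
\<close>

definition phi_closed_dfn :: "'a \<Rightarrow> 'a \<Rightarrow> bool" where
  "phi_closed_dfn x C \<longleftrightarrow>
    (\<forall>a b n k l m. a \<epsilon> omega \<and> b \<epsilon> omega \<and> n \<epsilon> omega \<and> k \<epsilon> omega \<and> l \<epsilon> omega \<and> m \<epsilon> omega \<longrightarrow>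
      computes_in C (code_dfn (num 0) a) n (num 0) \<and>
      computes_in C (code_dfn (num 1) a) n (succ n) \<and>
      computes_in C (code_dfn (num 2) a) (code_dfn n k) n \<and>
      computes_in C (code_dfn (num 3) a) (code_dfn n k) k \<and>
      computes_in C (code_dfn (num 4) a) n (app_dfn x n) \<and>
      (computes_in C a n k \<and> computes_in C b n m \<longrightarrow>
        computes_in C (code_dfn (num 5) (code_dfn a b)) n (code_dfn k m)) \<and>
      (computes_in C b n k \<and> computes_in C a k m \<longrightarrow>
        computes_in C (code_dfn (num 6) (code_dfn a b)) n m) \<and>
      (computes_in C a n m \<longrightarrow>
        computes_in C (code_dfn (num 7) (code_dfn a b)) (code_dfn n (num 0)) m) \<and>
      (computes_in C (code_dfn (num 7) (code_dfn a b)) (code_dfn n k) l \<and>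
       computes_in C b (code_dfn n (code_dfn k l)) m \<longrightarrow>
        computes_in C (code_dfn (num 7) (code_dfn a b)) (code_dfn n (succ k)) m) \<and>
      (computes_in C a (code_dfn n k) (num 0) \<longrightarrow>
        computes_in C (code_dfn (num 8) a) (code_dfn n k) k) \<and>
      (computes_in C a (code_dfn n k) (succ l) \<and>
       computes_in C (code_dfn (num 8) a) (code_dfn n (succ k)) m \<longrightarrow>
        computes_in C (code_dfn (num 8) a) (code_dfn n k) m) \<and>
      (computes_in C a n m \<longrightarrow>
        computes_in C (code_dfn (num 9) b) (code_dfn a n) m))"

definition phi_dfn :: "'a \<Rightarrow> 'a \<Rightarrow> 'a \<Rightarrow> 'a \<Rightarrow> bool" where
  "phi_dfn x e n m \<longleftrightarrow> (\<forall>C. phi_closed_dfn x C \<longrightarrow> computes_in C e n m)"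

lemma phi_closed_iff:
  assumes "x \<epsilon> cantor" shows "phi_closed x C \<longleftrightarrow> phi_closed_dfn x C"
  unfolding phi_closed_def phi_closed_dfn_def
  by (intro all_cong1 imp_cong refl) (simp add: code_dfn_eq app_dfn_cantor assms del: num.simps)

lemma phi_iff: "x \<epsilon> cantor \<Longrightarrow> phi x e n m \<longleftrightarrow> phi_dfn x e n m"
  unfolding phi_def phi_dfn_def by (simp add: phi_closed_iff)

lemma definable_phi:
  "definable_term x \<Longrightarrow> definable_term e \<Longrightarrow> definable_term n \<Longrightarrow> definable_term m \<Longrightarrow> definable
      (\<lambda>v. phi_dfn (x v) (e v) (n v) (m v))"
  by (rule definable_subst4)
    (unfold phi_dfn_def phi_closed_dfn_def computes_in_def, intro definable_intros_set
        definable_code)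

lemma phi_closedD:
  assumes "phi_closed x C" "a \<epsilon> omega" "b \<epsilon> omega" "n \<epsilon> omega" "k \<epsilon> omega" "l \<epsilon> omega" "m \<epsilon> omega"
  shows "computes_in C (code (num 0) a) n (num 0)"
    "computes_in C (code (num 1) a) n (succ n)"
    "computes_in C (code (num 2) a) (code n k) n"
    "computes_in C (code (num 3) a) (code n k) k"
    "computes_in C (code (num 4) a) n (app x n)"
    "computes_in C a n k \<Longrightarrow> computes_in C b n m \<Longrightarrow>
      computes_in C (code (num 5) (code a b)) n (code k m)"
    "computes_in C b n k \<Longrightarrow> computes_in C a k m \<Longrightarrow>
      computes_in C (code (num 6) (code a b)) n m"
    "computes_in C a n m \<Longrightarrow>
      computes_in C (code (num 7) (code a b)) (code n (num 0)) m"
    "computes_in C (code (num 7) (code a b)) (code n k) l \<Longrightarrow>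
      computes_in C b (code n (code k l)) m \<Longrightarrow>
      computes_in C (code (num 7) (code a b)) (code n (succ k)) m"
    "computes_in C a (code n k) (num 0) \<Longrightarrow> computes_in C (code (num 8) a) (code n k) k"
    "computes_in C a (code n k) (succ l) \<Longrightarrow>
      computes_in C (code (num 8) a) (code n (succ k)) m \<Longrightarrow>
      computes_in C (code (num 8) a) (code n k) m"
    "computes_in C a n m \<Longrightarrow> computes_in C (code (num 9) b) (code a n) m"
  using assms(1)[unfolded phi_closed_def, rule_format, of a b n k l m] assms(2-7)
  by (simp_all del: num.simps)

text \<open>
  The set of all triples of numbers is itself closed.
\<close>

lemma phi_omega:
  assumes "phi x e n m" "x \<epsilon> cantor" shows "e \<epsilon> omega" "n \<epsilon> omega" "m \<epsilon> omega"
proof -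
  have "phi_closed x omega3"
    unfolding phi_closed_def computes_in_def using assms(2) by (simp del: num.simps)
  then show "e \<epsilon> omega" "n \<epsilon> omega" "m \<epsilon> omega"
    using assms(1) unfolding phi_def computes_in_def by fastforce+
qed

definition p_zero where "p_zero = code (num 0) (num 0)"
definition p_succ where "p_succ = code (num 1) (num 0)"
definition p_fst where "p_fst = code (num 2) (num 0)"
definition p_snd where "p_snd = code (num 3) (num 0)"
definition p_query where "p_query = code (num 4) (num 0)"
definition p_pair where "p_pair a b = code (num 5) (code a b)"
definition p_comp where "p_comp a b = code (num 6) (code a b)"
definition p_rec where "p_rec a b = code (num 7) (code a b)"
definition p_search where "p_search a = code (num 8) a"
definition p_univ where "p_univ = code (num 9) (num 0)"

lemmas prog_defs = p_zero_def p_succ_def p_fst_def p_snd_def p_query_def p_pair_def p_comp_def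
    p_rec_def p_search_def p_univ_def

lemma p_omega [simp]:
  "p_zero \<epsilon> omega" "p_succ \<epsilon> omega" "p_fst \<epsilon> omega"
  "p_snd \<epsilon> omega" "p_query \<epsilon> omega" "p_univ \<epsilon> omega"
  "a \<epsilon> omega \<Longrightarrow> p_search a \<epsilon> omega"
  "a \<epsilon> omega \<Longrightarrow> b \<epsilon> omega \<Longrightarrow> p_pair a b \<epsilon> omega"
  "a \<epsilon> omega \<Longrightarrow> b \<epsilon> omega \<Longrightarrow> p_comp a b \<epsilon> omega"
  "a \<epsilon> omega \<Longrightarrow> b \<epsilon> omega \<Longrightarrow> p_rec a b \<epsilon> omega"
  unfolding prog_defs by (simp_all del: num.simps)

lemma phi_base:
  "n \<epsilon> omega \<Longrightarrow> phi x p_zero n (num 0)"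
  "n \<epsilon> omega \<Longrightarrow> phi x p_succ n (succ n)"
  "n \<epsilon> omega \<Longrightarrow> k \<epsilon> omega \<Longrightarrow> phi x p_fst (code n k) n"
  "n \<epsilon> omega \<Longrightarrow> k \<epsilon> omega \<Longrightarrow> phi x p_snd (code n k) k"
  "n \<epsilon> omega \<Longrightarrow> phi x p_query n (app x n)"
  unfolding phi_def prog_defs
  using phi_closedD(1-5)[OF _ omega_0 omega_0 _ _ omega_0 omega_0] omega_0 by blast+

lemma phi_pair:
  assumes x: "x \<epsilon> cantor" and "phi x a n k" "phi x b n m" shows "phi x (p_pair a b) n (code k m)"
  using assms(2,3) phi_closedD(6)[OF _ phi_omega(1)[OF assms(2) x] phi_omega(1)[OF assms(3) x]
    phi_omega(2,3)[OF assms(2) x] omega_0 phi_omega(3)[OF assms(3) x]]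
  unfolding phi_def prog_defs by blast

lemma phi_comp:
  assumes x: "x \<epsilon> cantor" and "phi x b n k" "phi x a k m" shows "phi x (p_comp a b) n m"
  using assms(2,3) phi_closedD(7)[OF _ phi_omega(1)[OF assms(3) x] phi_omega(1)[OF assms(2) x]
    phi_omega(2,3)[OF assms(2) x] omega_0 phi_omega(3)[OF assms(3) x]]
  unfolding phi_def prog_defs by blast

lemma phi_rec_0:
  assumes x: "x \<epsilon> cantor" and "phi x a n m" "b \<epsilon> omega" shows "phi x (p_rec a b) (code n (num 0)) m"
  using assms(2) phi_closedD(8)[OF _ phi_omega(1)[OF assms(2) x] assms(3)
    phi_omega(2)[OF assms(2) x] omega_0 omega_0 phi_omega(3)[OF assms(2) x]]
  unfolding phi_def prog_defs by blast

lemma phi_rec_succ: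
  assumes x: "x \<epsilon> cantor" and "a \<epsilon> omega" "n \<epsilon> omega" "k \<epsilon> omega"
    "phi x (p_rec a b) (code n k) l" "phi x b (code n (code k l)) m"
  shows "phi x (p_rec a b) (code n (succ k)) m"
  using assms(5,6) phi_closedD(9)[OF _ assms(2) phi_omega(1)[OF assms(6) x] assms(3,4)
    phi_omega(3)[OF assms(5) x] phi_omega(3)[OF assms(6) x]]
  unfolding phi_def prog_defs by blast

lemma phi_search_found:
  assumes x: "x \<epsilon> cantor" and "n \<epsilon> omega" "k \<epsilon> omega" "phi x a (code n k) (num 0)"
  shows "phi x (p_search a) (code n k) k"
  using assms(4) phi_closedD(10)[OF _ phi_omega(1)[OF assms(4) x] omega_0 assms(2,3) omega_0
      omega_0]
  unfolding phi_def prog_defs by blast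

lemma phi_search_next:
  assumes x: "x \<epsilon> cantor" and "n \<epsilon> omega" "k \<epsilon> omega" "l \<epsilon> omega" "phi x a (code n k) (succ l)"
    "phi x (p_search a) (code n (succ k)) m"
  shows "phi x (p_search a) (code n k) m"
  using assms(5,6) phi_closedD(11)[OF _ phi_omega(1)[OF assms(5) x] omega_0 assms(2,3,4)
    phi_omega(3)[OF assms(6) x]]
  unfolding phi_def prog_defs by blast

lemma phi_univ:
  assumes x: "x \<epsilon> cantor" and "phi x a n m" shows "phi x p_univ (code a n) m"
  using assms(2) phi_closedD(12)[OF _ phi_omega(1)[OF assms(2) x] omega_0
      phi_omega(2)[OF assms(2) x]
    omega_0 omega_0 phi_omega(3)[OF assms(2) x]]
  unfolding phi_def prog_defs by blast

definition p_id where "p_id = p_pair p_fst p_snd"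

lemma p_id_omega [simp]: "p_id \<epsilon> omega" unfolding p_id_def by simp

lemma phi_id: "x \<epsilon> cantor \<Longrightarrow> n \<epsilon> omega \<Longrightarrow> phi x p_id n n"
  by (erule code_cases) (auto simp: p_id_def intro!: phi_pair phi_base)

text \<open>
  An index of the constant function with value \<open>n\<close>, where \<open>n\<close> may be nonstandard. It is the
  \<open>n\<close>-fold composition of the successor with zero, hence found by induction inside the structure.
\<close>

lemma constant_index:
  assumes "n \<epsilon> omega"
  shows "\<exists>k. k \<epsilon> omega \<and> (\<forall>x m. x \<epsilon> cantor \<and> m \<epsilon> omega \<longrightarrow> phi x k m n)"
proof -
  have "\<exists>k. k \<epsilon> omega \<and> (\<forall>x m. x \<epsilon> cantor \<and> m \<epsilon> omega \<longrightarrow> phi_dfn x k m n)"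
  proof (rule omega_induct[OF assms])
    show "definable (\<lambda>e. \<exists>k. k \<epsilon> omega \<and> (\<forall>x m. x \<epsilon> cantor \<and> m \<epsilon> omega \<longrightarrow> phi_dfn x k m (e 0)))"
      by (intro definable_intros_set definable_phi)
    show "\<exists>k. k \<epsilon> omega \<and> (\<forall>x m. x \<epsilon> cantor \<and> m \<epsilon> omega \<longrightarrow> phi_dfn x k m (num 0))"
      using phi_base(1) by (auto simp flip: phi_iff intro!: exI[of _ p_zero])
    fix n assume "\<exists>k. k \<epsilon> omega \<and> (\<forall>x m. x \<epsilon> cantor \<and> m \<epsilon> omega \<longrightarrow> phi_dfn x k m n)" "n \<epsilon> omega"
    then obtain k where "k \<epsilon> omega" "\<And>x m. x \<epsilon> cantor \<Longrightarrow> m \<epsilon> omega \<Longrightarrow> phi x k m n" "n \<epsilon> omega"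
      using phi_iff by auto
    then show "\<exists>k. k \<epsilon> omega \<and> (\<forall>x m. x \<epsilon> cantor \<and> m \<epsilon> omega \<longrightarrow> phi_dfn x k m (succ n))"
      by (auto simp flip: phi_iff intro!: exI[of _ "p_comp p_succ k"] phi_comp phi_base)
  qed
  then show ?thesis by (auto simp: phi_iff)
qed

definition p_const where
  "p_const n = (SOME k. k \<epsilon> omega \<and> (\<forall>x m. x \<epsilon> cantor \<and> m \<epsilon> omega \<longrightarrow> phi x k m n))"

lemma p_const_omega [simp]: "n \<epsilon> omega \<Longrightarrow> p_const n \<epsilon> omega"
  and phi_const: "x \<epsilon> cantor \<Longrightarrow> m \<epsilon> omega \<Longrightarrow> n \<epsilon> omega \<Longrightarrow> phi x (p_const n) m n"
  using someI_ex[OF constant_index[of n]] unfolding p_const_def by blast+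

lemma rec_total:
  assumes x: "x \<epsilon> cantor" and "phi x a n m0" and "b \<epsilon> omega"
    and b: "\<And>k l. k \<epsilon> omega \<Longrightarrow> l \<epsilon> omega \<Longrightarrow> \<exists>m. phi x b (code n (code k l)) m"
    and k: "k \<epsilon> omega"
  shows "\<exists>m. phi x (p_rec a b) (code n k) m"
proof -
  note w [simp] = phi_omega[OF assms(2) x]
  have "\<exists>m. phi_dfn x (p_rec a b) (code_dfn n k) m"
  proof (rule omega_induct[OF k])
    show "definable (\<lambda>e. \<exists>m. phi_dfn x (p_rec a b) (code_dfn n (e 0)) m)"
      by (intro definable_intros_set definable_phi definable_code)
    show "\<exists>m. phi_dfn x (p_rec a b) (code_dfn n (num 0)) m"
      using phi_rec_0[OF x assms(2,3)] by (auto simp: code_dfn_eq phi_iff x)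
    fix k assume k: "k \<epsilon> omega" and "\<exists>m. phi_dfn x (p_rec a b) (code_dfn n k) m"
    then obtain l where l: "phi x (p_rec a b) (code n k) l" by (auto simp: code_dfn_eq phi_iff x)
    then obtain m where "phi x b (code n (code k l)) m" using b k phi_omega x by blast
    then show "\<exists>m. phi_dfn x (p_rec a b) (code_dfn n (succ k)) m"
      using phi_rec_succ[OF x w(1,2) k l] k by (auto simp: code_dfn_eq phi_iff x)
  qed
  then show ?thesis using k by (simp add: code_dfn_eq phi_iff x)
qed

definition p_pred where "p_pred = p_comp (p_rec p_zero (p_comp p_fst p_snd)) (p_pair p_zero p_id)"

lemma p_pred_omega [simp]: "p_pred \<epsilon> omega" unfolding p_pred_def by simp

lemmas phi_prog = phi_comp phi_pair phi_id phi_const phi_rec_0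

lemma phi_pred_succ:
  assumes x: "x \<epsilon> cantor" and k: "k \<epsilon> omega" shows "phi x p_pred (succ k) k"
proof -
  have B: "phi x (p_comp p_fst p_snd) (code (num 0) (code i l)) i" if "i \<epsilon> omega" "l \<epsilon> omega" for
      i l
    using that by - (rule phi_prog[OF x] phi_base | simp)+
  obtain l where l: "phi x (p_rec p_zero (p_comp p_fst p_snd)) (code (num 0) k) l"
    using rec_total[OF x phi_base(1)[OF omega_0] _ _ k, of "p_comp p_fst p_snd"] B by auto
  have "phi x (p_rec p_zero (p_comp p_fst p_snd)) (code (num 0) (succ k)) k"
    by (rule phi_rec_succ[OF x _ _ k l]) (use B k phi_omega[OF l x] in simp_all)
  then show ?thesis
    unfolding p_pred_def using k by - (rule phi_prog[OF x] phi_base | assumption | simp)+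
qed

text \<open>
  A branch must be run only if it is selected, since the other one may diverge. Therefore the test
  selects the index of a branch by primitive recursion (a constant at 0, another constant at
  successors), and the enumeration scheme then runs the selected index on the original input.
\<close>

definition p_cond where "p_cond t a b = p_comp p_univ
    (p_pair (p_comp (p_rec (p_const a) (p_comp (p_const b) p_zero)) (p_pair p_zero t)) p_id)"

lemma p_cond_omega [simp]: "t \<epsilon> omega \<Longrightarrow> a \<epsilon> omega \<Longrightarrow> b \<epsilon> omega \<Longrightarrow> p_cond t a b \<epsilon> omega"
  unfolding p_cond_def by simp

lemma phi_cond_0:
  assumes x: "x \<epsilon> cantor" and "phi x t n (num 0)" "phi x a n m" "b \<epsilon> omega"
  shows "phi x (p_cond t a b) n m"
proof -
  note [simp] = phi_omega[OF assms(2) x] phi_omega[OF assms(3) x] assms(4)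
  show ?thesis unfolding p_cond_def
    by (rule phi_comp[OF x phi_pair[OF x phi_comp[OF x phi_pair[OF x phi_base(1) assms(2)]]
        phi_id] phi_univ])
      (use x in \<open>auto intro!: phi_rec_0 phi_const assms\<close>)
qed

lemma phi_cond_succ:
  assumes x: "x \<epsilon> cantor" and "phi x t n (succ k)" "phi x b n m" "a \<epsilon> omega" "k \<epsilon> omega"
  shows "phi x (p_cond t a b) n m"
proof -
  note [simp] = phi_omega[OF assms(2) x] phi_omega[OF assms(3) x] assms(4,5)
  have B: "phi x (p_comp (p_const b) p_zero) (code (num 0) (code i l)) b" if "i \<epsilon> omega" "l \<epsilon>
      omega" for i l
    using that by - (rule phi_prog[OF x] phi_base | simp)+
  obtain l where l: "phi x (p_rec (p_const a) (p_comp (p_const b) p_zero)) (code (num 0) k) l"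
    using rec_total[OF x phi_const[of x "num 0" a] _ _ assms(5), of "p_comp (p_const b) p_zero"] B
        x by auto
  have R: "phi x (p_rec (p_const a) (p_comp (p_const b) p_zero)) (code (num 0) (succ k)) b"
    by (rule phi_rec_succ[OF x _ _ _ l]) (use B phi_omega[OF l x] in simp_all)
  show ?thesis unfolding p_cond_def
    by (rule phi_comp[OF x phi_pair[OF x phi_comp[OF x phi_pair[OF x phi_base(1) assms(2)]]
        phi_id] phi_univ])
      (use x R in \<open>auto intro!: assms\<close>)
qed

text \<open>
  A case distinction on the value of \<open>t\<close>: branch number \<open>i\<close> is run if the value is \<open>i\<close>.
\<close>

fun p_dispatch where
  "p_dispatch t [] = p_zero"
| "p_dispatch t (b # bs) = p_cond t b (p_dispatch (p_comp p_pred t) bs)"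

lemma p_dispatch_omega [simp]: "t \<epsilon> omega \<Longrightarrow> \<forall>b\<in>set bs. b \<epsilon> omega \<Longrightarrow> p_dispatch t bs \<epsilon> omega"
  by (induction bs arbitrary: t) auto

lemma phi_dispatch:
  assumes x: "x \<epsilon> cantor" and "phi x t n (num i)" "\<forall>b\<in>set bs. b \<epsilon> omega" "i < length bs"
    "phi x (bs ! i) n m"
  shows "phi x (p_dispatch t bs) n m"
  using assms(2-)
proof (induction bs arbitrary: t i)
  case (Cons b bs)
  note [simp] = phi_omega(1)[OF Cons.prems(1) x]
  show ?case
  proof (cases i)
    case 0
    then show ?thesis using Cons.prems x by (auto intro!: phi_cond_0)
  next
    case (Suc j)
    have "phi x (p_comp p_pred t) n (num j)"
      using Cons.prems(1) Suc phi_pred_succ[OF x] by (auto intro!: phi_comp[OF x])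
    then show ?thesis using Cons x Suc by (auto intro!: phi_cond_succ[of x t n "num j"])
  qed
qed simp

section \<open>Relative computation\<close>

\<comment> \<open>Numerals stay folded from here on, so that indices match the program
  constructors literally.\<close>
declare num.simps(2) [simp del]

text \<open>
  The interpreter works on inputs \<open>code r (code p (code c n))\<close>: \<open>r\<close> is the index of the
  interpreter itself, which makes recursive calls possible through the enumeration scheme without
  a fixed point theorem; \<open>p\<close> describes the oracle; \<open>c\<close> is the index to be run and \<open>n\<close> its input. A
  pair \<open>p = code q d\<close> describes the real whose bit \<open>m\<close> is the value of \<open>q\<close> at \<open>code d m\<close>.
\<close>

definition arg_oracle where "arg_oracle = p_comp p_fst p_snd"
definition arg_index where "arg_index = p_comp p_fst (p_comp p_snd p_snd)"
definition arg_input where "arg_input = p_comp p_snd (p_comp p_snd p_snd)"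
definition arg_kind where "arg_kind = p_comp p_fst arg_index"
definition arg_subindex where "arg_subindex = p_comp p_snd arg_index"
definition p_recurse where "p_recurse a n = p_comp p_univ
    (p_pair p_fst (p_pair p_fst (p_pair arg_oracle (p_pair a n))))"

lemma arg_omega [simp]: "arg_oracle \<epsilon> omega" "arg_index \<epsilon> omega" "arg_input \<epsilon> omega" "arg_kind \<epsilon>
    omega" "arg_subindex \<epsilon> omega"
  "a \<epsilon> omega \<Longrightarrow> n \<epsilon> omega \<Longrightarrow> p_recurse a n \<epsilon> omega"
  unfolding arg_oracle_def arg_index_def arg_input_def arg_kind_def arg_subindex_def p_recurse_def
      by simp_all

lemma phi_arg:
  assumes x: "x \<epsilon> cantor" and [simp]: "r \<epsilon> omega" "p \<epsilon> omega" "c \<epsilon> omega" "n \<epsilon> omega"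
  shows "phi x arg_oracle (code r (code p (code c n))) p"
    "phi x arg_index (code r (code p (code c n))) c"
    "phi x arg_input (code r (code p (code c n))) n"
  unfolding arg_oracle_def arg_index_def arg_input_def by (rule phi_prog[OF x] phi_base | simp)+

lemma phi_arg_code:
  assumes x: "x \<epsilon> cantor" and [simp]: "r \<epsilon> omega" "p \<epsilon> omega" "t \<epsilon> omega" "a \<epsilon> omega" "n \<epsilon> omega"
  shows "phi x arg_kind (code r (code p (code (code t a) n))) t"
    "phi x arg_subindex (code r (code p (code (code t a) n))) a"
  unfolding arg_kind_def arg_subindex_def by (rule phi_prog[OF x] phi_base phi_arg[OF x] | simp)+

lemma phi_recurse:
  assumes x: "x \<epsilon> cantor" and w: "r \<epsilon> omega" "p \<epsilon> omega" "c \<epsilon> omega" "n \<epsilon> omega"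
    and a: "phi x f (code r (code p (code c n))) a" and m: "phi x g (code r (code p (code c n))) m"
    and l: "phi x r (code r (code p (code a m))) l"
  shows "phi x (p_recurse f g) (code r (code p (code c n))) l"
  unfolding p_recurse_def
  by (rule phi_comp[OF x phi_pair[OF x phi_base(3) phi_pair[OF x phi_base(3)
      phi_pair[OF x phi_arg(1)[OF x] phi_pair[OF x a m]]]] phi_univ[OF x l]]) (use w in simp_all)

text \<open>
  One branch for each of the ten kinds of indices, in the order of their numbers. Branch 4 answers
  oracle queries by running the description of the oracle.
\<close>

definition eval_branches where
  "eval_branches =
    [p_zero,
     p_comp p_succ arg_input,
     p_comp p_fst arg_input,
     p_comp p_snd arg_input,
     p_comp p_univ
       (p_pair (p_comp p_fst arg_oracle) (p_pair (p_comp p_snd arg_oracle) arg_input)),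
     p_pair
       (p_recurse (p_comp p_fst arg_subindex) arg_input)
       (p_recurse (p_comp p_snd arg_subindex) arg_input),
     p_recurse (p_comp p_fst arg_subindex) (p_recurse (p_comp p_snd arg_subindex) arg_input),
     p_cond (p_comp p_snd arg_input)
       (p_recurse (p_comp p_fst arg_subindex) (p_comp p_fst arg_input))
       (p_recurse (p_comp p_snd arg_subindex)
         (p_pair (p_comp p_fst arg_input)
           (p_pair (p_comp p_pred (p_comp p_snd arg_input))
             (p_recurse arg_index
               (p_pair (p_comp p_fst arg_input) (p_comp p_pred (p_comp p_snd arg_input))))))),
     p_cond (p_recurse arg_subindex arg_input)
       (p_comp p_snd arg_input)
       (p_recurse arg_index
         (p_pair (p_comp p_fst arg_input) (p_comp p_succ (p_comp p_snd arg_input)))),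
     p_recurse (p_comp p_fst arg_input) (p_comp p_snd arg_input)]"

definition p_eval_body where "p_eval_body = p_dispatch arg_kind eval_branches"

lemma eval_branches_omega: "\<forall>b\<in>set eval_branches. b \<epsilon> omega"
  unfolding eval_branches_def by simp

lemma p_eval_body_omega [simp]: "p_eval_body \<epsilon> omega"
  unfolding p_eval_body_def by (simp add: eval_branches_omega)

lemma phi_eval_body:
  assumes x: "x \<epsilon> cantor" and "p \<epsilon> omega" "a \<epsilon> omega" "n \<epsilon> omega" "i < length eval_branches"
    "phi x (eval_branches ! i) (code p_eval_body (code p (code (code (num i) a) n))) l"
  shows "phi x p_eval_body (code p_eval_body (code p (code (code (num i) a) n))) l"
  unfolding p_eval_body_def
  by (rule phi_dispatch[OF x, of _ _ i]) (use assms eval_branches_omega in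
      \<open>auto simp: p_eval_body_def[symmetric] intro!: phi_arg_code\<close>)

text \<open>
  The computations that the interpreter simulates correctly satisfy all closure conditions for the
  oracle \<open>y\<close>, hence they include every computation with oracle \<open>y\<close>. In each case the branch of the
  interpreter is run on the assumed simulations of the subcomputations.
\<close>

lemma eval_closed:
  assumes x: "x \<epsilon> cantor" and y: "y \<epsilon> cantor" and [simp]: "q \<epsilon> omega" "d \<epsilon> omega"
    and orac: "\<And>m. m \<epsilon> omega \<Longrightarrow> phi x q (code d m) (app y m)"
    and C: "\<And>c n l. opair c (opair n l) \<epsilon> C \<longleftrightarrow> c \<epsilon> omega \<and> n \<epsilon> omega \<and> l \<epsilon> omega \<and>
      phi x p_eval_body (code p_eval_body (code (code q d) (code c n))) l"
  shows "phi_closed y C"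
proof -
  define p where "p = code q d"
  have p [simp]: "p \<epsilon> omega" unfolding p_def by simp
  define E where "E c n l \<longleftrightarrow> c \<epsilon> omega \<and> n \<epsilon> omega \<and> l \<epsilon> omega \<and>
    phi x p_eval_body (code p_eval_body (code p (code c n))) l" for c n l
  have E: "c \<epsilon> omega" "n \<epsilon> omega" "l \<epsilon> omega" "phi x p_eval_body
      (code p_eval_body (code p (code c n))) l"
    if "E c n l" for c n l
    using that unfolding E_def by blast+
  have B: "E (code (num i) a) n l" if "i < length eval_branches" "a \<epsilon> omega" "n \<epsilon> omega"
    "phi x (eval_branches ! i) (code p_eval_body (code p (code (code (num i) a) n))) l" for i a n l
    using that phi_eval_body[OF x p that(2,3,1,4)] phi_omega[OF that(4) x] unfolding E_def by simp
  note R = phi_prog[OF x] phi_base phi_arg[OF x] phi_arg_code[OF x] phi_pred_succ[OF x]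
      phi_recurse[OF x]
  \<comment> \<open>The twelve clauses of the definition of \<open>phi_closed\<close>, in their order.\<close>
  have 0: "E (code (num 0) a) n (num 0)" if [simp]: "a \<epsilon> omega" "n \<epsilon> omega" for a n
    by (rule B) (simp_all add: eval_branches_def, (rule R | simp)+)
  have 1: "E (code (num 1) a) n (succ n)" if [simp]: "a \<epsilon> omega" "n \<epsilon> omega" for a n
    by (rule B) (simp_all add: eval_branches_def, (rule R | simp)+)
  have 2: "E (code (num 2) a) (code n k) n"
    if [simp]: "a \<epsilon> omega" "n \<epsilon> omega" "k \<epsilon> omega" for a n k
    by (rule B) (simp_all add: eval_branches_def, (rule R | simp)+)
  have 3: "E (code (num 3) a) (code n k) k"
    if [simp]: "a \<epsilon> omega" "n \<epsilon> omega" "k \<epsilon> omega" for a n k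
    by (rule B) (simp_all add: eval_branches_def, (rule R | simp)+)
  have 4: "E (code (num 4) a) n (app y n)" if [simp]: "a \<epsilon> omega" "n \<epsilon> omega" for a n
    by (rule B) (simp_all add: eval_branches_def p_def, (rule R phi_univ[OF x orac] | simp)+)
  have 5: "E (code (num 5) (code a b)) n (code k m)"
    if a: "E a n k" and b: "E b n m" for a b n k m
  proof -
    note [simp] = E(1-3)[OF a] E(1-3)[OF b]
    show ?thesis
      by (rule B) (simp_all add: eval_branches_def, (rule R E(4)[OF a] E(4)[OF b] | simp)+)
  qed
  have 6: "E (code (num 6) (code a b)) n m"
    if b: "E b n k" and a: "E a k m" for a b n k m
  proof -
    note [simp] = E(1-3)[OF a] E(1-3)[OF b]
    show ?thesis
      by (rule B) (simp_all add: eval_branches_def, (rule R E(4)[OF a] E(4)[OF b] | simp)+)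
  qed
  have 7: "E (code (num 7) (code a b)) (code n (num 0)) m"
    if a: "E a n m" and [simp]: "b \<epsilon> omega" for a b n m
  proof -
    note [simp] = E(1-3)[OF a]
    show ?thesis
      by (rule B) (simp_all add: eval_branches_def, rule phi_cond_0[OF x],
          (rule R E(4)[OF a] | simp)+)
  qed
  have 8: "E (code (num 7) (code a b)) (code n (succ k)) m"
    if l: "E (code (num 7) (code a b)) (code n k) l" and m: "E b (code n (code k l)) m"
      and [simp]: "a \<epsilon> omega" "n \<epsilon> omega" "k \<epsilon> omega" for a b n k l m
  proof -
    note [simp] = E(1-3)[OF m] E(3)[OF l]
    show ?thesis
      by (rule B) (simp_all add: eval_branches_def, rule phi_cond_succ[OF x, of _ _ k],
          (rule R E(4)[OF l] E(4)[OF m] | simp)+)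
  qed
  have 9: "E (code (num 8) a) (code n k) k"
    if a: "E a (code n k) (num 0)" and [simp]: "n \<epsilon> omega" "k \<epsilon> omega" for a n k
  proof -
    note [simp] = E(1-3)[OF a]
    show ?thesis
      by (rule B) (simp_all add: eval_branches_def, rule phi_cond_0[OF x],
          (rule R E(4)[OF a] | simp)+)
  qed
  have 10: "E (code (num 8) a) (code n k) m"
    if a: "E a (code n k) (succ l)" and m: "E (code (num 8) a) (code n (succ k)) m"
      and [simp]: "n \<epsilon> omega" "k \<epsilon> omega" "l \<epsilon> omega" for a n k l m
  proof -
    note [simp] = E(1-3)[OF a] E(1-3)[OF m]
    show ?thesis
      by (rule B) (simp_all add: eval_branches_def, rule phi_cond_succ[OF x, of _ _ l],
          (rule R E(4)[OF a] E(4)[OF m] | simp)+)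
  qed
  have 11: "E (code (num 9) b) (code a n) m" if a: "E a n m" and [simp]: "b \<epsilon> omega" for a b n m
  proof -
    note [simp] = E(1-3)[OF a]
    show ?thesis
      by (rule B) (simp_all add: eval_branches_def, (rule R E(4)[OF a] | simp)+)
  qed
  have C': "opair c (opair n l) \<epsilon> C \<longleftrightarrow> E c n l" for c n l
    using C unfolding E_def p_def by blast
  show ?thesis
    unfolding phi_closed_def computes_in_def C'
    by (intro allI impI; elim conjE; intro conjI impI; (elim conjE)?;
        rule 0 1 2 3 4 5 6 7 8 9 10 11; assumption)
qed

definition p_eval where "p_eval = p_comp p_eval_body (p_pair (p_const p_eval_body) p_id)"

lemma p_eval_omega [simp]: "p_eval \<epsilon> omega" unfolding p_eval_def by simp

text \<open>
  \<open>p\<close> is a number from which \<open>x\<close> can compute \<open>y\<close>: a program \<open>q\<close> together with data \<open>d\<close> for it.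
  Keeping the data apart makes composition of reductions an explicit function of numbers, namely
  pairing (see \<open>presents_compose\<close>), and no substitution into indices is necessary when reductions
  are iterated.
\<close>

definition presents where
  "presents x p y \<longleftrightarrow> (\<exists>q d. q \<epsilon> omega \<and> d \<epsilon> omega \<and> p = code q d \<and>
    (\<forall>m. m \<epsilon> omega \<longrightarrow> phi x q (code d m) (app y m)))"

lemma presents_omega: "presents x p y \<Longrightarrow> p \<epsilon> omega"
  unfolding presents_def by auto

lemma phi_eval:
  assumes x: "x \<epsilon> cantor" and y: "y \<epsilon> cantor" and "presents x p y" and l: "phi y c n l"
  shows "phi x p_eval (code p (code c n)) l"
proof -
  obtain q d where [simp]: "q \<epsilon> omega" "d \<epsilon> omega" and p: "p = code q d" and
    orac: "\<And>m. m \<epsilon> omega \<Longrightarrow> phi x q (code d m) (app y m)"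
    using assms(3) unfolding presents_def by blast
  note [simp] = phi_omega[OF l y]
  have "definable (\<lambda>e. phi_dfn x p_eval_body (code_dfn p_eval_body
      (code_dfn (code q d) (code_dfn (e 0) (e 1)))) (e 2))"
    by (intro definable_intros_set definable_phi definable_code)
  from triples_exist[OF this] obtain C where
    "\<And>c n l. opair c (opair n l) \<epsilon> C \<longleftrightarrow> c \<epsilon> omega \<and> n \<epsilon> omega \<and> l \<epsilon> omega \<and>
      phi_dfn x p_eval_body (code_dfn p_eval_body (code_dfn (code q d) (code_dfn c n))) l" by blast
  then have C: "opair c (opair n l) \<epsilon> C \<longleftrightarrow> c \<epsilon> omega \<and> n \<epsilon> omega \<and> l \<epsilon> omega \<and>
      phi x p_eval_body (code p_eval_body (code (code q d) (code c n))) l" for c n l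
    by (auto simp: code_dfn_eq phi_iff x)
  from eval_closed[OF x y _ _ orac C] have "computes_in C c n l"
    using l unfolding phi_def by simp
  then have *: "phi x p_eval_body (code p_eval_body (code p (code c n))) l"
    using C p unfolding computes_in_def by simp
  show ?thesis unfolding p_eval_def
    by (rule phi_prog[OF x] * | simp add: p)+
qed

text \<open>
  Given the description \<open>p\<close> of a real \<open>y\<close> and an input \<open>m\<close>, run index \<open>c\<close> on \<open>m\<close> with oracle \<open>y\<close>.
\<close>

definition p_compose where "p_compose c = p_comp p_eval (p_pair p_fst (p_pair (p_const c) p_snd))"
definition self_presentation where "self_presentation = code (p_comp p_query p_snd) (num 0)"
text \<open>
  The universal reader: bit \<open>m\<close> of the real described by \<open>p\<close>, from \<open>code p m\<close>.
\<close>

definition p_ask where "p_ask = p_comp p_univ (p_pair (p_comp p_fst p_fst)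
    (p_pair (p_comp p_snd p_fst) p_snd))"

lemma p_compose_omega [simp]: "c \<epsilon> omega \<Longrightarrow> p_compose c \<epsilon> omega" unfolding p_compose_def by simp
lemma self_presentation_omega [simp]: "self_presentation \<epsilon> omega" unfolding self_presentation_def
    by simp
lemma p_ask_omega [simp]: "p_ask \<epsilon> omega" unfolding p_ask_def by simp

lemma presents_self: "x \<epsilon> cantor \<Longrightarrow> presents x self_presentation x"
  unfolding presents_def self_presentation_def
  by (intro exI[of _ "p_comp p_query p_snd"] exI[of _ "num 0"]) (auto intro!: phi_comp phi_base)

lemma presents_compose:
  assumes x: "x \<epsilon> cantor" and y: "y \<epsilon> cantor" and p: "presents x p y" and c [simp]: "c \<epsilon> omega"
    and z: "le_via z y c"
  shows "presents x (code (p_compose c) p) z"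
proof -
  note [simp] = presents_omega[OF p]
  have "phi x (p_compose c) (code p m) (app z m)" if m [simp]: "m \<epsilon> omega" for m
  proof -
    have "phi y c m (app z m)" using z m unfolding le_via_def by blast
    from phi_eval[OF x y p this] show ?thesis
      unfolding p_compose_def by - (rule phi_prog[OF x] phi_base | assumption | simp)+
  qed
  then show ?thesis unfolding presents_def by (intro exI[of _ "p_compose c"] exI[of _ p]) simp
qed

lemma phi_ask:
  assumes x: "x \<epsilon> cantor" and p: "presents x p y" and [simp]: "m \<epsilon> omega"
  shows "phi x p_ask (code p m) (app y m)"
proof -
  obtain q d where [simp]: "q \<epsilon> omega" "d \<epsilon> omega" "p = code q d" and
    orac: "\<And>m. m \<epsilon> omega \<Longrightarrow> phi x q (code d m) (app y m)"
    using p unfolding presents_def by blast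
  show ?thesis unfolding p_ask_def
    by (rule phi_prog[OF x] phi_base phi_univ[OF x orac] | simp)+
qed

lemma presents_le_T:
  assumes x: "x \<epsilon> cantor" and p: "presents x p y" shows "le_T y x"
proof -
  note [simp] = presents_omega[OF p]
  have "phi x (p_comp p_ask (p_pair (p_const p) p_id)) m (app y m)" if [simp]: "m \<epsilon> omega" for m
    by (rule phi_prog[OF x] phi_ask[OF x p] | simp)+
  then show ?thesis unfolding le_T_def le_via_def
    by (intro exI[of _ "p_comp p_ask (p_pair (p_const p) p_id)"]) simp
qed

lemma le_T_refl: "x \<epsilon> cantor \<Longrightarrow> le_T x x"
  using presents_le_T presents_self by blast

lemma le_T_trans:
  assumes "x \<epsilon> cantor" "y \<epsilon> cantor" "le_T z y" "le_T y x" shows "le_T z x"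
  using assms presents_self presents_compose presents_le_T unfolding le_T_def by meson

section \<open>Reals with a marker\<close>

declare One_nat_def [simp del]

text \<open>
  Column 0 of \<open>r\<close> is the characteristic function of \<open>{n}\<close>; all other columns are copies of \<open>t\<close>.
  Any single copy would do, but with copies in all of them a program needs to distinguish only
  zero from nonzero column numbers.
\<close>

definition is_mark :: "'a \<Rightarrow> 'a \<Rightarrow> 'a \<Rightarrow> bool" where
  "is_mark r n t \<longleftrightarrow> r \<epsilon> cantor \<and>
    (\<forall>m. m \<epsilon> omega \<longrightarrow> (m = n \<longrightarrow> app r (code (num 0) m) = num 1) \<and>
      (m \<noteq> n \<longrightarrow> app r (code (num 0) m) = num 0)) \<and>
    (\<forall>j m. j \<epsilon> omega \<and> m \<epsilon> omega \<longrightarrow> app r (code (succ j) m) = app t m)"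

definition is_mark_dfn :: "'a \<Rightarrow> 'a \<Rightarrow> 'a \<Rightarrow> bool" where
  "is_mark_dfn r n t \<longleftrightarrow> r \<epsilon> cantor \<and>
    (\<forall>m. m \<epsilon> omega \<longrightarrow> (m = n \<longrightarrow> app_dfn r (code_dfn (num 0) m) = num 1) \<and>
      (m \<noteq> n \<longrightarrow> app_dfn r (code_dfn (num 0) m) = num 0)) \<and>
    (\<forall>j m. j \<epsilon> omega \<and> m \<epsilon> omega \<longrightarrow> app_dfn r (code_dfn (succ j) m) = app_dfn t m)"

lemma is_mark_iff: "t \<epsilon> cantor \<Longrightarrow> is_mark r n t \<longleftrightarrow> is_mark_dfn r n t"
  unfolding is_mark_def is_mark_dfn_def
  by (intro conj_cong refl all_cong1 imp_cong) (auto simp: code_dfn_eq app_dfn_cantor)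

lemma is_mark_exists:
  assumes t: "t \<epsilon> cantor" and n: "n \<epsilon> omega" shows "\<exists>r. is_mark r n t"
proof -
  define P where "P c \<longleftrightarrow> c = code (num 0) n \<or>
    (\<exists>j m. j \<epsilon> omega \<and> m \<epsilon> omega \<and> c = code_dfn (succ j) m \<and> app_dfn t m = num 1)" for c
  have "definable (\<lambda>e. P (e 0))"
    unfolding P_def by (intro definable_intros_set definable_code)
  from real_exists[OF this] obtain r where
    r: "r \<epsilon> cantor" "\<And>c. c \<epsilon> omega \<Longrightarrow> app r c = (if P c then num 1 else num 0)" by blast
  have "P (code (num 0) m) \<longleftrightarrow> m = n" if "m \<epsilon> omega" for m
    using that n unfolding P_def by (auto simp: code_dfn_eq)
  moreover have "P (code (succ j) m) \<longleftrightarrow> app t m = num 1" if "j \<epsilon> omega" "m \<epsilon> omega" for j m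
    using that n unfolding P_def by (auto simp: code_dfn_eq app_dfn_cantor t cong: conj_cong)
  moreover have "(if app t m = num 1 then num 1 else num 0) = app t m" if "m \<epsilon> omega" for m
    using cantor_bit[OF t that] by auto
  ultimately have "is_mark r n t"
    unfolding is_mark_def using r by (simp del: One_nat_def)
  then show ?thesis by blast
qed

lemma is_mark_unique:
  assumes "is_mark r n t" "is_mark s n t" shows "r = s"
proof (rule cantor_ext)
  fix c assume "c \<epsilon> omega"
  then obtain j m where c: "j \<epsilon> omega" "m \<epsilon> omega" "c = code j m" by (rule code_cases)
  from c(1) show "app r c = app s c"
    by (cases rule: omega_cases; cases "m = n") (use c assms in \<open>auto simp: is_mark_def\<close>)
qed (use assms in \<open>auto simp: is_mark_def\<close>)

definition mark where "mark n t = (SOME r. is_mark r n t)"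

lemma is_mark_mark: "t \<epsilon> cantor \<Longrightarrow> n \<epsilon> omega \<Longrightarrow> is_mark (mark n t) n t"
  unfolding mark_def by (rule someI_ex[OF is_mark_exists])

lemma is_mark_eq: "t \<epsilon> cantor \<Longrightarrow> n \<epsilon> omega \<Longrightarrow> is_mark r n t \<longleftrightarrow> r = mark n t"
  using is_mark_mark is_mark_unique by blast

lemma mark_cantor [simp]: "t \<epsilon> cantor \<Longrightarrow> n \<epsilon> omega \<Longrightarrow> mark n t \<epsilon> cantor"
  using is_mark_mark unfolding is_mark_def by blast

lemma mark_app:
  assumes "t \<epsilon> cantor" "n \<epsilon> omega" "m \<epsilon> omega"
  shows "app (mark n t) (code (num 0) m) = (if m = n then num 1 else num 0)"
    "j \<epsilon> omega \<Longrightarrow> app (mark n t) (code (succ j) m) = app t m"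
  using is_mark_mark[OF assms(1,2)] assms(3) unfolding is_mark_def by auto

lemma mark_app_1: "t \<epsilon> cantor \<Longrightarrow> n \<epsilon> omega \<Longrightarrow> m \<epsilon> omega \<Longrightarrow>
    app (mark n t) (code (num 1) m) = app t m"
  using mark_app(2)[of t n m "num 0"] by (simp add: num_1)

text \<open>
  A program that computes a marked real is checked on column 0 and on the other columns
  separately.
\<close>

lemma le_via_markI:
  assumes "t \<epsilon> cantor" "n \<epsilon> omega"
    and "\<And>m. m \<epsilon> omega \<Longrightarrow> phi s e (code (num 0) m) (if m = n then num 1 else num 0)"
    and "\<And>j m. j \<epsilon> omega \<Longrightarrow> m \<epsilon> omega \<Longrightarrow> phi s e (code (succ j) m) (app t m)"
  shows "le_via (mark n t) s e"
  unfolding le_via_def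
proof (intro allI impI)
  fix c assume "c \<epsilon> omega"
  then obtain j m where c: "j \<epsilon> omega" "m \<epsilon> omega" "c = code j m" by (rule code_cases)
  from c(1) show "phi s e c (app (mark n t) c)"
    by (cases rule: omega_cases) (use c assms mark_app in auto)
qed

text \<open>
  \<open>p_up\<close> and \<open>p_down\<close> shift column 0 by one place, \<open>p_init\<close> adds a marker at position 0, and
  \<open>p_payload\<close> reads off column 1. None of them depends on the position of the marker.
\<close>

definition p_up where "p_up = p_cond p_fst (p_cond p_snd p_zero
    (p_comp p_query (p_pair p_zero (p_comp p_pred p_snd)))) p_query"
definition p_down where "p_down = p_cond p_fst (p_comp p_query
    (p_pair p_zero (p_comp p_succ p_snd))) p_query"
definition p_init where "p_init = p_cond p_fst (p_cond p_snd (p_const (num 1)) p_zero)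
    (p_comp p_query p_snd)"
definition p_payload where "p_payload = p_comp p_query (p_pair (p_const (num 1)) p_id)"

lemma p_mark_omega [simp]: "p_up \<epsilon> omega" "p_down \<epsilon> omega" "p_init \<epsilon> omega" "p_payload \<epsilon> omega"
  unfolding p_up_def p_down_def p_init_def p_payload_def by simp_all

lemma phi_query: "x \<epsilon> cantor \<Longrightarrow> n \<epsilon> omega \<Longrightarrow> app x n = b \<Longrightarrow> phi x p_query n b"
  using phi_base(5) by blast

lemma le_via_up:
  assumes [simp]: "t \<epsilon> cantor" "n \<epsilon> omega" shows "le_via (mark (succ n) t) (mark n t) p_up"
proof (rule le_via_markI)
  have x: "mark n t \<epsilon> cantor" by simp
  note R = phi_prog[OF x] phi_pred_succ[OF x] phi_query[OF x] phi_base
  fix m assume m [simp]: "m \<epsilon> omega"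
  from m show "phi (mark n t) p_up (code (num 0) m) (if m = succ n then num 1 else num 0)"
  proof (cases rule: omega_cases)
    case 1
    then show ?thesis unfolding p_up_def
      by simp (rule phi_cond_0[OF x] R | simp)+
  next
    case (2 k)
    show ?thesis unfolding p_up_def 2(2)
      by (rule phi_cond_0[OF x], rule phi_base, simp, simp add: 2(1), rule phi_cond_succ[OF x],
          (rule R | simp add: mark_app 2(1))+)
  qed
  show "phi (mark n t) p_up (code (succ j) m) (app t m)" if [simp]: "j \<epsilon> omega" for j
    unfolding p_up_def by (rule phi_cond_succ[OF x], (rule R | simp add: mark_app)+)
qed simp_all

lemma le_via_down:
  assumes [simp]: "t \<epsilon> cantor" "n \<epsilon> omega" shows "le_via (mark n t) (mark (succ n) t) p_down"
proof (rule le_via_markI)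
  have x: "mark (succ n) t \<epsilon> cantor" by simp
  note R = phi_prog[OF x] phi_pred_succ[OF x] phi_query[OF x] phi_base
  fix m assume m [simp]: "m \<epsilon> omega"
  show "phi (mark (succ n) t) p_down (code (num 0) m) (if m = n then num 1 else num 0)"
    unfolding p_down_def by (rule phi_cond_0[OF x], (rule R | simp add: mark_app)+)
  show "phi (mark (succ n) t) p_down (code (succ j) m) (app t m)" if [simp]: "j \<epsilon> omega" for j
    unfolding p_down_def by (rule phi_cond_succ[OF x], (rule R | simp add: mark_app)+)
qed simp_all

lemma le_via_init:
  assumes x [simp]: "t \<epsilon> cantor" shows "le_via (mark (num 0) t) t p_init"
proof (rule le_via_markI)
  note R = phi_prog[OF x] phi_pred_succ[OF x] phi_query[OF x] phi_base
  fix m assume m [simp]: "m \<epsilon> omega"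
  from m show "phi t p_init (code (num 0) m) (if m = num 0 then num 1 else num 0)"
  proof (cases rule: omega_cases)
    case 1
    then show ?thesis unfolding p_init_def
      by simp (rule phi_cond_0[OF x] R | simp)+
  next
    case (2 k)
    show ?thesis unfolding p_init_def 2(2)
      by (rule phi_cond_0[OF x], rule phi_base, simp, simp add: 2(1), rule phi_cond_succ[OF x],
          (rule R | simp add: mark_app 2(1))+)
  qed
  show "phi t p_init (code (succ j) m) (app t m)" if [simp]: "j \<epsilon> omega" for j
    unfolding p_init_def by (rule phi_cond_succ[OF x], (rule R | simp add: mark_app)+)
qed simp_all

lemma le_via_payload:
  assumes [simp]: "t \<epsilon> cantor" "n \<epsilon> omega" shows "le_via t (mark n t) p_payload"
proof -
  have x: "mark n t \<epsilon> cantor" by simp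
  have "phi (mark n t) p_payload m (app t m)" if [simp]: "m \<epsilon> omega" for m
    unfolding p_payload_def by (rule phi_prog[OF x] phi_query[OF x] | simp add: mark_app_1)+
  then show ?thesis unfolding le_via_def by blast
qed

definition payload_presentation where "payload_presentation = code
    (p_comp p_query (p_pair (p_const (num 1)) p_snd)) (num 0)"

lemma payload_presentation_omega [simp]: "payload_presentation \<epsilon> omega" unfolding
    payload_presentation_def by simp

lemma presents_payload:
  assumes [simp]: "t \<epsilon> cantor" "n \<epsilon> omega" shows "presents (mark n t) payload_presentation t"
proof -
  have x: "mark n t \<epsilon> cantor" by simp
  have "phi (mark n t) (p_comp p_query (p_pair (p_const (num 1)) p_snd)) (code (num 0) m) (app t m)"
    if [simp]: "m \<epsilon> omega" for m
    by (rule phi_prog[OF x] phi_query[OF x] phi_base | simp add: mark_app_1)+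
  then show ?thesis unfolding presents_def payload_presentation_def
    by (intro exI[of _ "p_comp p_query (p_pair (p_const (num 1)) p_snd)"] exI[of _ "num 0"]) simp
qed

definition p_unmarked where "p_unmarked = p_cond (p_comp p_query (p_pair p_zero p_snd))
    (p_const (num 1)) p_zero"
definition p_find where "p_find = p_comp (p_search p_unmarked) (p_pair p_id p_zero)"

lemma p_find_omega [simp]: "p_unmarked \<epsilon> omega" "p_find \<epsilon> omega"
  unfolding p_unmarked_def p_find_def by simp_all

text \<open>
  The marker is found by unbounded search for a 1 in column 0.
\<close>

lemma phi_find:
  assumes t [simp]: "t \<epsilon> cantor" and n [simp]: "n \<epsilon> omega" and v [simp]: "v \<epsilon> omega"
  shows "phi (mark n t) p_find v n"
proof -
  let ?s = "mark n t"
  have x: "?s \<epsilon> cantor" by simp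
  note R = phi_prog[OF x] phi_query[OF x] phi_base
  have hit: "phi ?s p_unmarked (code v n) (num 0)"
    unfolding p_unmarked_def
    by (rule phi_cond_succ[OF x, of _ _ "num 0"]) ((rule R | simp add: mark_app num_1)+)
  have miss: "phi ?s p_unmarked (code v k) (succ (num 0))" if [simp]: "k \<epsilon> omega" and k: "k \<noteq> n"
      for k
    unfolding p_unmarked_def
    by (rule phi_cond_0[OF x]) ((rule R | simp add: mark_app k num_1)+)
  \<comment> \<open>The search rules proceed downwards from the hit at \<open>n\<close>. An upward induction on
    \<open>k\<close> proves instead that a search which succeeds from \<open>k\<close> on also succeeds from 0
    on, for \<open>k \<le> n\<close>.\<close>
  have "k \<epsilon> succ n \<longrightarrow> phi_dfn ?s (p_search p_unmarked) (code_dfn v k) n \<longrightarrow> phi_dfn ?s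
      (p_search p_unmarked) (code_dfn v (num 0)) n"
    if "k \<epsilon> omega" for k
  proof (rule omega_induct[OF that])
    show "definable (\<lambda>e. e 0 \<epsilon> succ n \<longrightarrow> phi_dfn ?s (p_search p_unmarked) (code_dfn v (e 0)) n \<longrightarrow>
        phi_dfn ?s (p_search p_unmarked) (code_dfn v (num 0)) n)"
      by (intro definable_intros_set definable_phi definable_code)
    fix k assume k [simp]: "k \<epsilon> omega" and IH: "k \<epsilon> succ n \<longrightarrow> phi_dfn ?s (p_search p_unmarked)
        (code_dfn v k) n \<longrightarrow>
        phi_dfn ?s (p_search p_unmarked) (code_dfn v (num 0)) n"
    show "succ k \<epsilon> succ n \<longrightarrow> phi_dfn ?s (p_search p_unmarked) (code_dfn v (succ k)) n \<longrightarrow>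
        phi_dfn ?s (p_search p_unmarked) (code_dfn v (num 0)) n"
    proof (intro impI)
      assume "succ k \<epsilon> succ n" and *: "phi_dfn ?s (p_search p_unmarked) (code_dfn v (succ k)) n"
      then have kn: "k \<epsilon> n" using succ_mem_succ[OF n] by blast
      then have "k \<noteq> n" by auto
      then have "phi ?s (p_search p_unmarked) (code v k) n"
        using phi_search_next[OF x v k omega_0 miss[OF k]] * by (simp add: phi_iff code_dfn_eq)
      then show "phi_dfn ?s (p_search p_unmarked) (code_dfn v (num 0)) n"
        using IH kn by (simp add: phi_iff code_dfn_eq)
    qed
  qed simp
  from this[OF n] have *: "phi ?s (p_search p_unmarked) (code v (num 0)) n"
    using phi_search_found[OF x v n hit] by (simp add: phi_iff code_dfn_eq)
  show ?thesis unfolding p_find_def by (rule R * | simp)+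
qed

text \<open>
  \<open>p_switch i\<close> replaces the real \<open>x\<close> under a marker at \<open>n\<close> by \<open>y\<close> in case \<open>x(n) = 1\<close>, where \<open>i\<close>
  computes \<open>y\<close> from \<open>x\<close>. \<open>p_unswitch k j\<close> undoes this: the bit \<open>k\<close>, at which \<open>x\<close> and \<open>y\<close> differ,
  tells whether the replacement took place, and \<open>j\<close> computes \<open>x\<close> from \<open>y\<close>.
\<close>

definition p_switch where
  "p_switch i = p_cond p_fst p_query (p_cond (p_comp p_query (p_pair (p_const (num 1)) p_find))
      p_query
    (p_comp p_eval (p_pair (p_const payload_presentation) (p_pair (p_const i) p_snd))))"

definition p_unswitch where
  "p_unswitch k j = p_cond p_fst p_query (p_cond (p_comp p_query
      (p_pair (p_const (num 1)) (p_const k))) p_query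
    (p_comp p_eval (p_pair (p_const payload_presentation) (p_pair (p_const j) p_snd))))"

lemma p_switch_omega [simp]: "i \<epsilon> omega \<Longrightarrow> p_switch i \<epsilon> omega"
  "k \<epsilon> omega \<Longrightarrow> i \<epsilon> omega \<Longrightarrow> p_unswitch k i \<epsilon> omega"
  unfolding p_switch_def p_unswitch_def by simp_all

lemma le_via_switch:
  assumes [simp]: "x \<epsilon> cantor" "y \<epsilon> cantor" "n \<epsilon> omega" "i \<epsilon> omega" and i: "le_via y x i"
  shows "le_via (mark n (if app x n = num 0 then x else y)) (mark n x) (p_switch i)"
proof (rule le_via_markI)
  have X: "mark n x \<epsilon> cantor" by simp
  note R = phi_prog[OF X] phi_query[OF X] phi_find phi_base
  fix m assume m [simp]: "m \<epsilon> omega"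
  show "phi (mark n x) (p_switch i) (code (num 0) m) (if m = n then num 1 else num 0)"
    unfolding p_switch_def by (rule phi_cond_0[OF X], (rule R | simp add: mark_app)+)
  fix j assume j [simp]: "j \<epsilon> omega"
  have "phi x i m (app y m)" using i unfolding le_via_def by simp
  note E = phi_eval[OF X _ presents_payload this]
  have b: "phi (mark n x) (p_comp p_query (p_pair (p_const (num 1)) p_find)) (code (succ j) m)
      (app x n)"
    by (rule R | simp add: mark_app_1)+
  consider "app x n = num 0" | "app x n = succ (num 0)"
    using cantor_bit[of x n] by (auto simp: num_1)
  then show "phi (mark n x) (p_switch i) (code (succ j) m)
      (app (if app x n = num 0 then x else y) m)"
  proof cases
    case 1
    show ?thesis unfolding p_switch_def
      by (rule phi_cond_succ[OF X], rule R, simp, simp, rule phi_cond_0[OF X], rule b[unfolded 1])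
        ((rule R | simp add: mark_app 1)+)
  next
    case 2
    show ?thesis unfolding p_switch_def
      by (rule phi_cond_succ[OF X], rule R, simp, simp, rule phi_cond_succ[OF X], rule
          b[unfolded 2])
        ((rule R E | simp add: 2)+)
  qed
qed simp_all

lemma le_via_unswitch:
  assumes [simp]: "x \<epsilon> cantor" "y \<epsilon> cantor" "n \<epsilon> omega" "j \<epsilon> omega" "k \<epsilon> omega"
    and j: "le_via x y j" and k: "app x k = num 0" "app y k = num 1" and z: "z = x \<or> z = y"
  shows "le_via (mark n x) (mark n z) (p_unswitch k j)"
proof (rule le_via_markI)
  have zc [simp]: "z \<epsilon> cantor" using z assms by blast
  have X: "mark n z \<epsilon> cantor" by simp
  note R = phi_prog[OF X] phi_query[OF X] phi_base
  fix m assume m [simp]: "m \<epsilon> omega"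
  show "phi (mark n z) (p_unswitch k j) (code (num 0) m) (if m = n then num 1 else num 0)"
    unfolding p_unswitch_def by (rule phi_cond_0[OF X], (rule R | simp add: mark_app)+)
  fix l assume l [simp]: "l \<epsilon> omega"
  have b: "phi (mark n z) (p_comp p_query (p_pair (p_const (num 1)) (p_const k)))
      (code (succ l) m) (app z k)"
    by (rule R | simp add: mark_app_1)+
  show "phi (mark n z) (p_unswitch k j) (code (succ l) m) (app x m)"
    using z
  proof
    assume z: "z = x"
    show ?thesis unfolding p_unswitch_def
      by (rule phi_cond_succ[OF X], rule R, simp, simp, rule phi_cond_0[OF X], rule
          b[unfolded z k, folded z])
        ((rule R | simp add: mark_app z)+)
  next
    assume z: "z = y"
    have E: "phi (mark n z) p_eval (code payload_presentation (code j m)) (app x m)"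
      using phi_eval[OF X \<open>z \<epsilon> cantor\<close> presents_payload, of j m "app x m"] j z unfolding
          le_via_def by simp
    have "app z k = succ (num 0)" using k z num_1 by simp
    note b = b[unfolded this]
    show ?thesis unfolding p_unswitch_def
      by (rule phi_cond_succ[OF X], rule R, simp, simp, rule phi_cond_succ[OF X], rule b)
        ((rule R E | simp)+)
  qed
qed simp_all

section \<open>Computing a real from its value\<close>

definition presents_dfn where
  "presents_dfn x p y \<longleftrightarrow> (\<exists>q d. q \<epsilon> omega \<and> d \<epsilon> omega \<and> p = code_dfn q d \<and>
    (\<forall>m. m \<epsilon> omega \<longrightarrow> phi_dfn x q (code_dfn d m) (app_dfn y m)))"

lemma presents_iff:
  assumes "x \<epsilon> cantor" "y \<epsilon> cantor" shows "presents x p y \<longleftrightarrow> presents_dfn x p y"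
  unfolding presents_def presents_dfn_def
  by (intro ex_cong1 conj_cong refl all_cong1 imp_cong)
    (simp_all add: code_dfn_eq app_dfn_cantor phi_iff assms)

text \<open>
  Both programs iterate the reduction \<open>c\<close>, on input \<open>code 0 n\<close>. \<open>path_up\<close> computes the number
  obtained from \<open>p\<close> by \<open>n\<close> compositions with \<open>c\<close>. \<open>path_down\<close> computes an index of the function
  which performs \<open>n\<close> compositions on its argument; the literal 6 in it builds this index as a
  composition. The two forms differ because the start of the downward path depends on \<open>n\<close>: the
  recursion must add the new step at the beginning of the path, and an index of a function can be
  extended there.
\<close>

definition path_up where "path_up c p = p_rec (p_const p)
    (p_pair (p_const (p_compose c)) (p_comp p_snd p_snd))"

lemma path_up_omega [simp]: "c \<epsilon> omega \<Longrightarrow> p \<epsilon> omega \<Longrightarrow> path_up c p \<epsilon> omega"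
  unfolding path_up_def by simp

definition path_down where
  "path_down c = p_rec (p_const p_id) (p_pair (p_const (num 6))
      (p_pair (p_comp p_snd p_snd) (p_const (p_pair (p_const (p_compose c)) p_id))))"

lemma path_down_omega [simp]: "c \<epsilon> omega \<Longrightarrow> path_down c \<epsilon> omega"
  unfolding path_down_def by simp

lemma path_up:
  assumes X: "X \<epsilon> cantor" and t: "t \<epsilon> cantor" and c [simp]: "c \<epsilon> omega"
    and f: "\<And>s. s \<epsilon> cantor \<Longrightarrow> app_dfn f s \<epsilon> cantor"
    and p: "presents X p (app_dfn f (mark (num 0) t))"
    and step: "\<And>n. n \<epsilon> omega \<Longrightarrow> le_via (app_dfn f (mark (succ n) t)) (app_dfn f (mark n t)) c"
    and n: "n \<epsilon> omega"
  shows "\<exists>q. phi X (path_up c p) (code (num 0) n) q \<and> presents X q (app_dfn f (mark n t))"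
proof -
  define P where "P n \<longleftrightarrow> (\<exists>q. phi_dfn X (path_up c p) (code_dfn (num 0) n) q \<and>
    (\<forall>w. is_mark_dfn w n t \<longrightarrow> presents_dfn X q (app_dfn f w)))" for n
  have [simp]: "p \<epsilon> omega" using presents_omega[OF p] .
  have P: "P n \<longleftrightarrow> (\<exists>q. phi X (path_up c p) (code (num 0) n) q \<and> presents X q (app_dfn f (mark n t)))"
    if [simp]: "n \<epsilon> omega" for n
    unfolding P_def is_mark_iff[OF t, symmetric] is_mark_eq[OF t that]
    using X t f by (simp add: code_dfn_eq phi_iff presents_iff)
  have "P n"
  proof (rule omega_induct[OF n])
    show "definable (\<lambda>e. P (e 0))"
      unfolding P_def is_mark_dfn_def presents_dfn_def by
          (intro definable_intros_set definable_phi definable_code)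
    have "phi X (path_up c p) (code (num 0) (num 0)) p"
      unfolding path_up_def by (rule phi_prog[OF X] | simp)+
    then show "P (num 0)" using p P by auto
  next
    fix n assume n [simp]: "n \<epsilon> omega" and "P n"
    then obtain q where q: "phi X (path_up c p) (code (num 0) n) q"
      "presents X q (app_dfn f (mark n t))" using P by auto
    note [simp] = presents_omega[OF q(2)]
    have "phi X (path_up c p) (code (num 0) (succ n)) (code (p_compose c) q)"
      unfolding path_up_def
      by (rule phi_rec_succ[OF X _ _ _ q(1)[unfolded path_up_def]])
        (simp_all, (rule phi_prog[OF X] phi_base | simp)+)
    moreover have "presents X (code (p_compose c) q) (app_dfn f (mark (succ n) t))"
      by (rule presents_compose[OF X _ q(2)]) (use t f step in auto)
    ultimately show "P (succ n)" using P[of "succ n"] by auto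
  qed
  then show ?thesis using P n by blast
qed

lemma path_down:
  assumes X: "X \<epsilon> cantor" and t: "t \<epsilon> cantor" and c [simp]: "c \<epsilon> omega"
    and f: "\<And>s. s \<epsilon> cantor \<Longrightarrow> app_dfn f s \<epsilon> cantor"
    and step: "\<And>n. n \<epsilon> omega \<Longrightarrow> le_via (app_dfn f (mark n t)) (app_dfn f (mark (succ n) t)) c"
    and n: "n \<epsilon> omega"
  shows "\<exists>q. phi X (path_down c) (code (num 0) n) q \<and>
    (\<forall>p. presents X p (app_dfn f (mark n t)) \<longrightarrow>
      (\<exists>p'. phi X q p p' \<and> presents X p' (app_dfn f (mark (num 0) t))))"
proof -
  let ?F = "app_dfn f (mark (num 0) t)"
  define P where "P n \<longleftrightarrow> (\<exists>q. phi_dfn X (path_down c) (code_dfn (num 0) n) q \<and>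
    (\<forall>p w. is_mark_dfn w n t \<longrightarrow> presents_dfn X p (app_dfn f w) \<longrightarrow>
      (\<exists>p'. phi_dfn X q p p' \<and> presents_dfn X p' ?F)))" for n
  have P: "P n \<longleftrightarrow> (\<exists>q. phi X (path_down c) (code (num 0) n) q \<and>
    (\<forall>p. presents X p (app_dfn f (mark n t)) \<longrightarrow> (\<exists>p'. phi X q p p' \<and> presents X p' ?F)))"
    if [simp]: "n \<epsilon> omega" for n
    unfolding P_def is_mark_iff[OF t, symmetric] is_mark_eq[OF t that]
    using X t f by (simp add: code_dfn_eq phi_iff presents_iff)
  have "P n"
  proof (rule omega_induct[OF n])
    show "definable (\<lambda>e. P (e 0))"
      unfolding P_def is_mark_dfn_def presents_dfn_def by
          (intro definable_intros_set definable_phi definable_code)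
    have "phi X (path_down c) (code (num 0) (num 0)) p_id"
      unfolding path_down_def by (rule phi_prog[OF X] | simp)+
    then show "P (num 0)" using P phi_id[OF X] presents_omega by (metis omega_0)
  next
    fix n assume n [simp]: "n \<epsilon> omega" and "P n"
    then obtain q where q: "phi X (path_down c) (code (num 0) n) q"
      "\<And>p. presents X p (app_dfn f (mark n t)) \<Longrightarrow> \<exists>p'. phi X q p p' \<and> presents X p' ?F" using P by
          auto
    have [simp]: "q \<epsilon> omega" using phi_omega[OF q(1) X] by simp
    let ?T = "p_pair (p_const (p_compose c)) p_id"
    have "phi X (path_down c) (code (num 0) (succ n)) (code (num 6) (code q ?T))"
      unfolding path_down_def
      by (rule phi_rec_succ[OF X _ _ _ q(1)[unfolded path_down_def]])
        (simp_all, (rule phi_prog[OF X] phi_base | simp)+)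
    moreover have "\<exists>p'. phi X (p_comp q ?T) p p' \<and> presents X p' ?F"
      if p: "presents X p (app_dfn f (mark (succ n) t))" for p
    proof -
      note [simp] = presents_omega[OF p]
      have "presents X (code (p_compose c) p) (app_dfn f (mark n t))"
        by (rule presents_compose[OF X _ p]) (use t f step in auto)
      then obtain p' where p': "phi X q (code (p_compose c) p) p'" "presents X p' ?F" using q(2)
          by blast
      have "phi X (p_comp q ?T) p p'" by (rule phi_prog[OF X] p' | simp)+
      then show ?thesis using p' by blast
    qed
    ultimately show "P (succ n)" unfolding P[OF omega_succ[OF n]] p_comp_def by blast
  qed
  then show ?thesis using P n by blast
qed

text \<open>
  The walk described at the beginning, for a position \<open>k\<close> with \<open>x(k) = 0\<close> and \<open>y(k) = 1\<close>. The
  hypothesis on \<open>u\<close> is uniform invariance with the first component of the translated pair of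
  indices.
\<close>

lemma decode_from_values:
  assumes x [simp]: "x \<epsilon> cantor" and y [simp]: "y \<epsilon> cantor"
    and k: "k \<epsilon> omega" "app x k = num 0" "app y k = num 1"
    and i: "i \<epsilon> omega" "le_via y x i" and j: "j \<epsilon> omega" "le_via x y j"
    and z0: "z0 \<epsilon> cantor" "le_T z0 x" "le_T z0 y"
    and f: "\<And>s. s \<epsilon> cantor \<Longrightarrow> app_dfn f s \<epsilon> cantor"
    and u: "\<And>s t i j. \<lbrakk>s \<epsilon> cantor; t \<epsilon> cantor; le_T z0 s; le_T z0 t; i \<epsilon> omega; j \<epsilon> omega;
        le_via t s i; le_via s t j\<rbrakk> \<Longrightarrow> u i j \<epsilon> omega \<and> le_via (app_dfn f t) (app_dfn f s) (u i j)"
    and ne: "app_dfn f x \<noteq> app_dfn f y"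
  shows "le_T x (app_dfn f x)"
proof -
  let ?F = "app_dfn f" let ?X = "app_dfn f x"
  \<comment> \<open>The real that encodes the bit \<open>x(n)\<close>.\<close>
  define z where "z n = (if app x n = num 0 then x else y)" for n
  have X: "?X \<epsilon> cantor" using f x by blast
  have zxy: "z n = x \<or> z n = y" for n unfolding z_def by auto
  have z [simp]: "z n \<epsilon> cantor" and z0z: "le_T z0 (z n)" for n
    using zxy[of n] z0 x y by metis+
  have m0: "le_T z0 (mark n t)" if "t \<epsilon> cantor" "n \<epsilon> omega" "le_T z0 t" for t n
  proof -
    have "le_T t (mark n t)" unfolding le_T_def using le_via_payload[OF that(1,2)] p_mark_omega(4)
        by blast
    then show ?thesis using le_T_trans[of "mark n t" t z0] that by simp
  qed
  have c0: "u p_init p_payload \<epsilon> omega" "le_via (?F (mark (num 0) x)) ?X (u p_init p_payload)"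
    using u[of x "mark (num 0) x" p_init p_payload] le_via_init le_via_payload m0 z0 x by auto
  have e0: "u p_payload p_init \<epsilon> omega" "le_via (?F (z n)) (?F (mark (num 0) (z n)))
      (u p_payload p_init)" for n
    using u[of "mark (num 0) (z n)" "z n" p_payload p_init] le_via_init le_via_payload m0
        z0z[of n] z by auto
  have c1': "u p_up p_down \<epsilon> omega \<and> le_via (?F (mark (succ n) x)) (?F (mark n x)) (u p_up p_down)"
    if [simp]: "n \<epsilon> omega" for n
    by (rule u) (simp_all add: le_via_up le_via_down m0 z0)
  note c1 = c1'[OF omega_0, THEN conjunct1] c1'[THEN conjunct2]
  have d1': "u p_down p_up \<epsilon> omega \<and>
      le_via (?F (mark n (z l))) (?F (mark (succ n) (z l))) (u p_down p_up)"
    if [simp]: "n \<epsilon> omega" for n l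
    by (rule u) (simp_all add: le_via_up le_via_down m0 z0z)
  note d1 = d1'[OF omega_0, THEN conjunct1] d1'[THEN conjunct2]
  have cm': "u (p_switch i) (p_unswitch k j) \<epsilon> omega \<and>
      le_via (?F (mark n (z n))) (?F (mark n x)) (u (p_switch i) (p_unswitch k j))"
    if n [simp]: "n \<epsilon> omega" for n
    by (rule u) (use le_via_switch[OF x y n i, folded z_def]
      le_via_unswitch[OF x y n j(1) k(1) j(2) k(2,3) zxy] in \<open>simp_all add: m0 z0 z0z i j k\<close>)
  note cm = cm'[OF omega_0, THEN conjunct1] cm'[THEN conjunct2]
  define p0 where "p0 = code (p_compose (u p_init p_payload)) self_presentation"
  have p0: "presents ?X p0 (?F (mark (num 0) x))"
    unfolding p0_def by (rule presents_compose[OF X X presents_self[OF X] c0])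
  note [simp] = presents_omega[OF p0] c0(1) e0(1) c1(1) d1(1) cm(1)
  \<comment> \<open>The bit at which \<open>f(x)\<close> and \<open>f(y)\<close> differ; its value in \<open>f(z n)\<close> decides between
    \<open>x\<close> and \<open>y\<close>.\<close>
  obtain b where b: "b \<epsilon> omega" "app ?X b \<noteq> app (?F y) b"
    using cantor_ext[OF X, of "?F y"] f ne by auto
  define A where "A = (if app ?X b = num 0 then p_zero else p_const (num 1))"
  define B where "B = (if app ?X b = num 0 then p_const (num 1) else p_zero)"
  have AB [simp]: "A \<epsilon> omega" "B \<epsilon> omega" unfolding A_def B_def by auto
  \<comment> \<open>\<open>Q\<close> maps \<open>n\<close> to a presentation of \<open>f(mark 0 (z n))\<close>, and \<open>R\<close> maps it to the bit
    \<open>b\<close> of \<open>f(z n)\<close>.\<close>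
  define Q where "Q = p_comp p_univ (p_pair (p_comp (path_down (u p_down p_up))
      (p_pair p_zero p_id))
    (p_pair (p_const (p_compose (u (p_switch i) (p_unswitch k j))))
        (p_comp (path_up (u p_up p_down) p0) (p_pair p_zero p_id))))"
  define R where "R = p_comp p_ask (p_pair (p_pair (p_const (p_compose (u p_payload p_init))) Q)
      (p_const b))"
  have [simp]: "Q \<epsilon> omega" "R \<epsilon> omega" unfolding Q_def R_def using b by simp_all
  have R: "phi ?X R n (app (?F (z n)) b)" if n [simp]: "n \<epsilon> omega" for n
  proof -
    obtain p where p: "phi ?X (path_up (u p_up p_down) p0) (code (num 0) n) p"
      "presents ?X p (?F (mark n x))"
      using path_up[OF X x c1(1) f p0 c1(2) n] by blast
    have p1: "presents ?X (code (p_compose (u (p_switch i) (p_unswitch k j))) p)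
        (?F (mark n (z n)))"
      by (rule presents_compose[OF X _ p(2) cm(1) cm(2)]) (use f in auto)
    obtain q where q: "phi ?X (path_down (u p_down p_up)) (code (num 0) n) q"
      "\<And>p. presents ?X p (?F (mark n (z n))) \<Longrightarrow>
        \<exists>p'. phi ?X q p p' \<and> presents ?X p' (?F (mark (num 0) (z n)))"
      using path_down[OF X z d1(1) f d1(2) n] by blast
    obtain p2 where p2: "phi ?X q (code (p_compose (u (p_switch i) (p_unswitch k j))) p) p2"
      "presents ?X p2 (?F (mark (num 0) (z n)))" using q(2)[OF p1] by blast
    have p3: "presents ?X (code (p_compose (u p_payload p_init)) p2) (?F (z n))"
      by (rule presents_compose[OF X _ p2(2) e0(1) e0(2)]) (use f in auto)
    have Q: "phi ?X Q n p2" unfolding Q_def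
      by (rule phi_prog[OF X] phi_base p(1) q(1) phi_univ[OF X p2(1)] | simp)+
    show ?thesis unfolding R_def
      by (rule phi_prog[OF X] phi_ask[OF X p3] Q | simp add: b)+
  qed
  have "phi ?X (p_cond R A B) n (app x n)" if n [simp]: "n \<epsilon> omega" for n
  proof -
    consider "app (?F (z n)) b = num 0" | "app (?F (z n)) b = succ (num 0)"
      using cantor_bit[of "?F (z n)" b] f b by (auto simp: num_1)
    then show ?thesis
    proof cases
      case 1
      have "phi ?X A n (app x n)"
      proof (cases "app ?X b = num 0")
        case True
        then have "app x n = num 0" using 1 b(2) unfolding z_def by (auto split: if_splits)
        then show ?thesis using True phi_base(1)[OF n] unfolding A_def by simp
      next
        case False
        then have "app x n = num 1" using 1 cantor_bit[OF x n] unfolding z_def by auto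
        then show ?thesis using False phi_const[OF X n] unfolding A_def by simp
      qed
      then show ?thesis using phi_cond_0[OF X R[OF n, unfolded 1]] by simp
    next
      case 2
      have "phi ?X B n (app x n)"
      proof (cases "app ?X b = num 0")
        case True
        then have "app x n = num 1" using 2 cantor_bit[OF x n] unfolding z_def by auto
        then show ?thesis using True phi_const[OF X n] unfolding B_def by simp
      next
        case False
        then have "app ?X b = succ (num 0)" using cantor_bit[OF X b(1)] num_1 by auto
        then have "app x n = num 0" using 2 b(2) unfolding z_def by (auto split: if_splits)
        then show ?thesis using False phi_base(1)[OF n] unfolding B_def by simp
      qed
      then show ?thesis using phi_cond_succ[OF X R[OF n, unfolded 2]] by simp
    qed
  qed
  then show ?thesis unfolding le_T_def le_via_def by (intro exI[of _ "p_cond R A B"]) simp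
qed

section \<open>Cones and determinacy\<close>

definition le_T_dfn where
  "le_T_dfn x y \<longleftrightarrow> (\<exists>i. i \<epsilon> omega \<and> (\<forall>n. n \<epsilon> omega \<longrightarrow> phi_dfn y i n (app_dfn x n)))"

lemma le_T_iff: "x \<epsilon> cantor \<Longrightarrow> y \<epsilon> cantor \<Longrightarrow> le_T x y \<longleftrightarrow> le_T_dfn x y"
  unfolding le_T_def le_T_dfn_def le_via_def
  by (intro ex_cong1 conj_cong refl all_cong1 imp_cong) (simp_all add: app_dfn_cantor phi_iff)

lemma definable_le_T:
  assumes "definable_term t" "definable_term s" shows "definable (\<lambda>e. le_T_dfn (t e) (s e))"
  by (rule definable_subst2[OF _ assms])
    (unfold le_T_dfn_def, intro definable_intros_set definable_phi)

lemma mem_cone: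
  assumes z: "z \<epsilon> cantor" shows "x \<epsilon> cone z \<longleftrightarrow> x \<epsilon> cantor \<and> le_T z x"
proof -
  have D: "definable (\<lambda>e. e 0 \<epsilon> cantor \<and> le_T_dfn z (e 0))" by
      (intro definable_intros_set definable_le_T)
  have "\<exists>s. \<forall>x. x \<epsilon> s \<longleftrightarrow> x \<epsilon> cantor \<and> le_T z x"
    using bounded_coll[OF D, of cantor] le_T_iff[OF z] by (auto cong: conj_cong)
  then show ?thesis unfolding cone_def by (rule mem_coll)
qed

lemma cantor_bit_if:
  "x \<epsilon> cantor \<Longrightarrow> n \<epsilon> omega \<Longrightarrow> (if app x n = num 1 then num 1 else num 0) = app x n"
  using cantor_bit[of x n] by auto

lemma real_of_columns:
  assumes "definable (\<lambda>e. R (e 0) (e 1))"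
  obtains r where "r \<epsilon> cantor"
    "\<And>n m. n \<epsilon> omega \<Longrightarrow> m \<epsilon> omega \<Longrightarrow> app r (code n m) = (if R n m then num 1 else num 0)"
proof -
  have D: "definable (\<lambda>e. \<exists>n m. n \<epsilon> omega \<and> m \<epsilon> omega \<and> e 0 = code_dfn n m \<and> R n m)"
    by (intro definable_intros_set definable_code definable_swap[OF assms])
  from real_exists[OF D] obtain r where r: "r \<epsilon> cantor" "\<And>c. c \<epsilon> omega \<Longrightarrow>
    app r c = (if \<exists>n m. n \<epsilon> omega \<and> m \<epsilon> omega \<and> c = code_dfn n m \<and> R n m then num 1 else num 0)"
    by blast
  have "(\<exists>n' m'. n' \<epsilon> omega \<and> m' \<epsilon> omega \<and> code n m = code_dfn n' m' \<and> R n' m') \<longleftrightarrow> R n m"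
    if "n \<epsilon> omega" "m \<epsilon> omega" for n m
    using that by (auto simp: code_dfn_eq cong: conj_cong)
  then show thesis using that[of r] r by simp
qed

lemma le_T_column:
  assumes r: "r \<epsilon> cantor" and n [simp]: "n \<epsilon> omega"
    and "\<And>m. m \<epsilon> omega \<Longrightarrow> app r (code n m) = app x m"
  shows "le_T x r"
proof -
  have "phi r (p_comp p_query (p_pair (p_const n) p_id)) m (app x m)" if [simp]: "m \<epsilon> omega" for m
    by (rule phi_prog[OF r] phi_query[OF r] | simp add: assms(3))+
  then show ?thesis unfolding le_T_def le_via_def
    by (intro exI[of _ "p_comp p_query (p_pair (p_const n) p_id)"]) simp
qed

lemma upper_bound:
  assumes x: "x \<epsilon> cantor" and y: "y \<epsilon> cantor"
  obtains r where "r \<epsilon> cantor" "le_T x r" "le_T y r"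
proof -
  have "definable (\<lambda>e. e 0 = num 0 \<and> app_dfn x (e 1) = num 1 \<or> e 0 \<noteq> num 0 \<and> app_dfn y (e 1) = num
      1)"
    by (intro definable_intros_set)
  from real_of_columns[OF this] obtain r where r: "r \<epsilon> cantor"
    "\<And>n m. n \<epsilon> omega \<Longrightarrow> m \<epsilon> omega \<Longrightarrow> app r (code n m) =
      (if n = num 0 \<and> app_dfn x m = num 1 \<or> n \<noteq> num 0 \<and> app_dfn y m = num 1 then num 1 else num 0)"
    by blast
  have "le_T x r"
    by (rule le_T_column[OF r(1), of "num 0"])
      (use r(2) cantor_bit_if[OF x] in \<open>simp_all add: app_dfn_cantor x\<close>)
  moreover have "le_T y r"
    by (rule le_T_column[OF r(1), of "num 1"])
      (use r(2)[of "num 1"] cantor_bit_if[OF y] num_1 in \<open>simp_all add: app_dfn_cantor y\<close>)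
  ultimately show thesis using that r(1) by blast
qed

lemma app_restr: "a \<epsilon> A \<Longrightarrow> app (restr f A) a = app f a"
proof -
  assume a: "a \<epsilon> A"
  have "definable (\<lambda>e. e 0 \<epsilon> f \<and> (\<exists>a b. a \<epsilon> A \<and> e 0 = opair a b))" by (intro definable_intros_set)
  then have "\<exists>s. \<forall>p. p \<epsilon> s \<longleftrightarrow> p \<epsilon> f \<and> (\<exists>a b. a \<epsilon> A \<and> p = opair a b)"
    by (rule bounded_coll) blast
  from mem_coll[OF this] have "opair a b \<epsilon> restr f A \<longleftrightarrow> opair a b \<epsilon> f" for b
    unfolding restr_def using a by auto
  then show ?thesis unfolding app_def by simp
qed

text \<open>
  Turing determinacy for predicates. Definability guarantees that the class is a set of the
  structure.
\<close>

lemma TD_dichotomy: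
  assumes TD "definable (\<lambda>e. P (e 0))"
    and inv: "\<forall>x y. x \<epsilon> cantor \<and> y \<epsilon> cantor \<and> P x \<and> le_T x y \<and> le_T y x \<longrightarrow> P y"
  obtains z where "z \<epsilon> cantor" "\<And>x. x \<epsilon> cone z \<Longrightarrow> P x"
  | z where "z \<epsilon> cantor" "\<And>x. x \<epsilon> cone z \<Longrightarrow> \<not> P x"
proof -
  obtain A where A: "\<And>x. x \<epsilon> A \<longleftrightarrow> x \<epsilon> cantor \<and> P x"
    using Separation[OF assms(2), of cantor] by blast
  have "(\<forall>x. x \<epsilon> A \<longrightarrow> x \<epsilon> cantor) \<and>
         (\<forall>x y. x \<epsilon> A \<and> y \<epsilon> cantor \<and> equiv_T x y \<longrightarrow> y \<epsilon> A)"
    unfolding A equiv_T_def using inv by blast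
  with assms(1) have "(\<exists>z. z \<epsilon> cantor \<and> (\<forall>x. x \<epsilon> cone z \<longrightarrow> x \<epsilon> A)) \<or>
       (\<exists>z. z \<epsilon> cantor \<and> (\<forall>x. x \<epsilon> cone z \<longrightarrow> \<not> x \<epsilon> A))"
    unfolding TD_def by blast
  then show thesis
  proof (elim disjE exE conjE)
    fix z assume "z \<epsilon> cantor" "\<forall>x. x \<epsilon> cone z \<longrightarrow> x \<epsilon> A"
    then show thesis using that(1)[of z] A by blast
  next
    fix z assume z: "z \<epsilon> cantor" "\<forall>x. x \<epsilon> cone z \<longrightarrow> \<not> x \<epsilon> A"
    show thesis by (rule that(2)[of z]) (use z A mem_cone in blast)+
  qed
qed

lemma succ_mono:
  assumes "k \<epsilon> omega" shows "\<forall>m. m \<epsilon> succ k \<longrightarrow> succ m \<epsilon> succ (succ k)"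
  by (rule omega_induct[OF assms]) (auto intro!: definable_intros_set)

text \<open>
  Only the first component of the translated pair of indices is kept. It may be a function of the
  metatheory because it will be evaluated at finitely many pairs only.
\<close>

lemma UTI_index_function:
  assumes U: "UTI (restr f (cone z0)) (cone z0)" and z0: "z0 \<epsilon> cantor"
    and f: "is_fun f cantor cantor"
  obtains v where "\<And>s t i j. \<lbrakk>s \<epsilon> cantor; t \<epsilon> cantor; le_T z0 s; le_T z0 t; i \<epsilon> omega; j \<epsilon> omega;
        le_via t s i; le_via s t j\<rbrakk> \<Longrightarrow> v i j \<epsilon> omega \<and> le_via (app_dfn f t) (app_dfn f s) (v i j)"
proof -
  obtain u where u: "is_fun u (prod_set omega omega) (prod_set omega omega)"
    "\<And>x y i j. \<lbrakk>x \<epsilon> cone z0; y \<epsilon> cone z0; i \<epsilon> omega; j \<epsilon> omega; equiv_via x y i j\<rbrakk> \<Longrightarrow>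
      \<exists>i' j'. app u (opair i j) = opair i' j' \<and>
        equiv_via (app (restr f (cone z0)) x) (app (restr f (cone z0)) y) i' j'"
    using U unfolding UTI_def by metis
  define v where "v i j = (THE i'. \<exists>j'. app u (opair i j) = opair i' j')" for i j
  have "v i j \<epsilon> omega \<and> le_via (app_dfn f t) (app_dfn f s) (v i j)"
    if s: "s \<epsilon> cantor" "le_T z0 s" and t: "t \<epsilon> cantor" "le_T z0 t" and ij: "i \<epsilon> omega" "j \<epsilon> omega"
      and via: "le_via t s i" "le_via s t j" for s t i j
  proof -
    have st: "s \<epsilon> cone z0" "t \<epsilon> cone z0" using s t mem_cone[OF z0] by auto
    then obtain i' j' where ij': "app u (opair i j) = opair i' j'"
      "equiv_via (app f s) (app f t) i' j'"
      using u(2)[OF st ij] via app_restr unfolding equiv_via_def by metis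
    have "v i j = i'" unfolding v_def ij'(1) by auto
    moreover have "i' \<epsilon> omega" using is_fun_app[OF u(1), of "opair i j"] ij ij'(1) by simp
    ultimately show ?thesis
      using ij'(2) app_dfn_eq[OF f] s t unfolding equiv_via_def by simp
  qed
  then show thesis using that by blast
qed

context
  fixes f z0
  assumes f: "is_fun f cantor cantor" and z0 [simp]: "z0 \<epsilon> cantor"
    and U: "UTI (restr f (cone z0)) (cone z0)"
begin

lemma value_cantor [simp]: "x \<epsilon> cantor \<Longrightarrow> app_dfn f x \<epsilon> cantor"
  using app_dfn_eq[OF f] is_fun_app[OF f] by simp

lemma value_invariant:
  assumes "x \<epsilon> cantor" "y \<epsilon> cantor" "le_T z0 x" "le_T z0 y" "le_T x y" "le_T y x"
  shows "le_T (app_dfn f x) (app_dfn f y)"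
proof -
  obtain v where v: "\<And>s t i j. \<lbrakk>s \<epsilon> cantor; t \<epsilon> cantor; le_T z0 s; le_T z0 t; i \<epsilon> omega; j \<epsilon> omega;
        le_via t s i; le_via s t j\<rbrakk> \<Longrightarrow> v i j \<epsilon> omega \<and> le_via (app_dfn f t) (app_dfn f s) (v i j)"
    using UTI_index_function[OF U z0 f] by blast
  show ?thesis using v assms unfolding le_T_def[of x y] le_T_def[of y x]
      le_T_def[of "app_dfn f x"] by blast
qed

text \<open>
  At a bit where \<open>x\<close> and \<open>y\<close> differ, one of them is 0 and the other is 1. If it is \<open>y\<close> that has
  the 0, the roles are exchanged and the result is carried over along \<open>x \<equiv>\<^sub>T y\<close> and \<open>f(x) \<equiv>\<^sub>T
  f(y)\<close>.
\<close>

lemma local_dichotomy: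
  assumes x: "x \<epsilon> cantor" "le_T z0 x" and y: "y \<epsilon> cantor" "le_T z0 y"
    and xy: "le_T x y" "le_T y x" and ne: "app_dfn f x \<noteq> app_dfn f y"
  shows "le_T x (app_dfn f x)"
proof -
  obtain v where v: "\<And>s t i j. \<lbrakk>s \<epsilon> cantor; t \<epsilon> cantor; le_T z0 s; le_T z0 t; i \<epsilon> omega; j \<epsilon> omega;
        le_via t s i; le_via s t j\<rbrakk> \<Longrightarrow> v i j \<epsilon> omega \<and> le_via (app_dfn f t) (app_dfn f s) (v i j)"
    using UTI_index_function[OF U z0 f] by blast
  obtain i j where i: "i \<epsilon> omega" "le_via y x i" and j: "j \<epsilon> omega" "le_via x y j"
    using xy unfolding le_T_def by blast
  obtain k where k: "k \<epsilon> omega" "app x k \<noteq> app y k"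
    using cantor_ext[OF x(1) y(1)] ne by blast
  then consider "app x k = num 0" "app y k = num 1" | "app y k = num 0" "app x k = num 1"
    using cantor_bit[OF x(1) k(1)] cantor_bit[OF y(1) k(1)] by metis
  then show ?thesis
  proof cases
    case 1
    show ?thesis
      by (rule decode_from_values[OF x(1) y(1) k(1) 1 i j z0 x(2) y(2) value_cantor v ne])
  next
    case 2
    have "le_T y (app_dfn f y)"
      by (rule decode_from_values[OF y(1) x(1) k(1) 2 j i z0 y(2) x(2) value_cantor v
          ne[symmetric]])
    moreover have "le_T (app_dfn f y) (app_dfn f x)" using value_invariant x y xy by blast
    ultimately show ?thesis using le_T_trans value_cantor x y xy by meson
  qed
qed

end
end

section \<open>Martin's conjecture for uniformly invariant functions\<close>

context ZF_DC
begin

text \<open>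
  Dependent choice does not control where the sequence starts. Therefore the pairs \<open>(n, z)\<close> to
  choose from require \<open>z\<close> to be good for all numbers up to \<open>n\<close>, and it is enough that the first
  components of the chosen sequence increase by one at each step. The columns of the real \<open>r\<close> are
  the second components.
\<close>

lemma countable_cones:
  assumes D: "definable (\<lambda>e. good (e 0) (e 1))"
    and mono: "\<And>n z z'. \<lbrakk>z \<epsilon> cantor; z' \<epsilon> cantor; le_T z z'; good n z\<rbrakk> \<Longrightarrow> good n z'"
    and ex: "\<And>n. n \<epsilon> omega \<Longrightarrow> \<exists>z. z \<epsilon> cantor \<and> good n z"
  obtains r where "r \<epsilon> cantor" "\<And>n. n \<epsilon> omega \<Longrightarrow> good n r"
proof -
  define G where "G n z \<longleftrightarrow> (\<forall>m. m \<epsilon> succ n \<longrightarrow> good m z)" for n z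
  have DG: "definable (\<lambda>e. G (e 0) (e 1))"
    unfolding G_def by (intro definable_intros_set definable_subst2[OF D])
  have exG: "\<exists>z. z \<epsilon> cantor \<and> G n z" if "n \<epsilon> omega" for n
  proof (rule omega_induct[OF that])
    show "definable (\<lambda>e. \<exists>z. z \<epsilon> cantor \<and> G (e 0) z)"
      by (intro definable_intros_set definable_subst2[OF DG])
    show "\<exists>z. z \<epsilon> cantor \<and> G (num 0) z" using ex[OF omega_0] unfolding G_def by simp
    fix n assume n: "n \<epsilon> omega" "\<exists>z. z \<epsilon> cantor \<and> G n z"
    then obtain z where z: "z \<epsilon> cantor" "G n z" by blast
    obtain z' where z': "z' \<epsilon> cantor" "good (succ n) z'" using ex[OF omega_succ[OF n(1)]] by blast
    obtain r where "r \<epsilon> cantor" "le_T z r" "le_T z' r" using upper_bound[OF z(1) z'(1)] .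
    then show "\<exists>z. z \<epsilon> cantor \<and> G (succ n) z"
      using z z' mono unfolding G_def by (metis mem_succ)
  qed
  obtain X where X: "\<And>n z. opair n z \<epsilon> X \<longleftrightarrow> n \<epsilon> omega \<and> z \<epsilon> cantor \<and> G n z"
    "\<And>p. p \<epsilon> X \<Longrightarrow> p \<epsilon> prod_set omega cantor" using pairs_exist[OF DG] by blast
  have "definable (\<lambda>e. \<exists>n z z'. e 0 = opair n z \<and> e 1 = opair (succ n) z')" by
      (intro definable_intros_set)
  from pairs_exist[OF this, of X X] obtain R where R: "\<And>p q. opair p q \<epsilon> R \<longleftrightarrow> p \<epsilon> X \<and> q \<epsilon> X \<and>
    (\<exists>n z z'. p = opair n z \<and> q = opair (succ n) z')" by metis
  have "\<exists>p. p \<epsilon> X" using exG[OF omega_0] X(1)[of "num 0"] by auto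
  moreover have "\<forall>p. p \<epsilon> X \<longrightarrow> (\<exists>q. q \<epsilon> X \<and> opair p q \<epsilon> R)"
  proof (intro allI impI)
    fix p assume p: "p \<epsilon> X"
    then obtain n z where nz: "p = opair n z" "n \<epsilon> omega" using X(2) mem_prod_set by blast
    then obtain z' where "z' \<epsilon> cantor" "G (succ n) z'" using exG[of "succ n"] by auto
    then show "\<exists>q. q \<epsilon> X \<and> opair p q \<epsilon> R"
      using p nz by (intro exI[of _ "opair (succ n) z'"]) (simp add: R X(1))
  qed
  ultimately obtain s where s: "is_fun s omega X"
    "\<And>n. n \<epsilon> omega \<Longrightarrow> opair (app s n) (app s (succ n)) \<epsilon> R"
    using dependent_choice by blast
  have "\<exists>k z. app_dfn s n = opair k z \<and> n \<epsilon> succ k" if "n \<epsilon> omega" for n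
  proof (rule omega_induct[OF that])
    show "definable (\<lambda>e. \<exists>k z. app_dfn s (e 0) = opair k z \<and> e 0 \<epsilon> succ k)"
      by (intro definable_intros_set)
    have "app s (num 0) \<epsilon> X" using s by simp
    then obtain k z where "app s (num 0) = opair k z" "k \<epsilon> omega" using X(2) mem_prod_set by blast
    then show "\<exists>k z. app_dfn s (num 0) = opair k z \<and> num 0 \<epsilon> succ k"
      using zero_mem_succ app_dfn_eq[OF s(1)] omega_0 by metis
    fix n assume n: "n \<epsilon> omega" and "\<exists>k z. app_dfn s n = opair k z \<and> n \<epsilon> succ k"
    then obtain k z where k: "app s n = opair k z" "n \<epsilon> succ k" using app_dfn_eq[OF s(1)] by metis
    have "app s n \<epsilon> X" using s n by simp
    then have "k \<epsilon> omega" using k X(1) by simp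
    then have "succ n \<epsilon> succ (succ k)" using succ_mono k by blast
    moreover obtain z' where "app s (succ n) = opair (succ k) z'"
      using s(2)[OF n] unfolding R k by auto
    ultimately show "\<exists>k z. app_dfn s (succ n) = opair k z \<and> succ n \<epsilon> succ k"
      using app_dfn_eq[OF s(1)] n omega_succ by metis
  qed
  then have s': "\<exists>k z. app s n = opair k z \<and> z \<epsilon> cantor \<and> good n z" if "n \<epsilon> omega" for n
    using that app_dfn_eq[OF s(1) that] is_fun_app[OF s(1) that] X(1) unfolding G_def by metis
  have "definable (\<lambda>e. \<exists>k z. app_dfn s (e 0) = opair k z \<and> app_dfn z (e 1) = num 1)"
    by (intro definable_intros_set)
  from real_of_columns[OF this] obtain r where r: "r \<epsilon> cantor"
    "\<And>n m. n \<epsilon> omega \<Longrightarrow> m \<epsilon> omega \<Longrightarrow> app r (code n m) =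
      (if \<exists>k z. app_dfn s n = opair k z \<and> app_dfn z m = num 1 then num 1 else num 0)" by blast
  have "good n r" if n: "n \<epsilon> omega" for n
  proof -
    obtain k z where z: "app s n = opair k z" "z \<epsilon> cantor" "good n z" using s'[OF n] by blast
    have "app r (code n m) = app z m" if m: "m \<epsilon> omega" for m
      using r(2)[OF n m] z cantor_bit_if[OF z(2) m] app_dfn_cantor[OF z(2) m] app_dfn_eq[OF s(1) n]
      by simp
    then show ?thesis using le_T_column[OF r(1) n] mono z r(1) by blast
  qed
  then show thesis using that r(1) by blast
qed

text \<open>
  The second alternative arises if the determinacy of \<open>{x. x \<le>\<^sub>T f(x)}\<close> gives a cone disjoint from
  that set. Above its base, \<open>f\<close> takes one value on each degree by \<open>local_dichotomy\<close>, so
  determinacy applies to every bit of \<open>f\<close>, and the value of \<open>f\<close> at the base of a cone that settles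
  all bits is the constant.
\<close>

theorem uniform_martin:
  assumes TD and f: "is_fun f cantor cantor" and "UTI_on_cone f"
  shows "on_cone (\<lambda>x. le_T x (app f x)) \<or> (\<exists>y. y \<epsilon> cantor \<and> on_cone (\<lambda>x. app f x = y))"
proof -
  obtain z0 where z0 [simp]: "z0 \<epsilon> cantor" and U: "UTI (restr f (cone z0)) (cone z0)"
    using assms(3) unfolding UTI_on_cone_def by blast
  let ?F = "app_dfn f"
  have Fc [simp]: "?F x \<epsilon> cantor" if "x \<epsilon> cantor" for x using value_cantor[OF f z0 U that] .
  have inv: "le_T (?F x) (?F y)"
    if "x \<epsilon> cantor" "y \<epsilon> cantor" "le_T z0 x" "le_T z0 y" "le_T x y" "le_T y x" for x y
    using value_invariant[OF f z0 U that] .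
  have F: "app f x = ?F x" if "x \<epsilon> cantor" for x using app_dfn_eq[OF f that] by simp
  define P where "P x \<longleftrightarrow> x \<epsilon> cantor \<and> le_T_dfn z0 x \<and> le_T_dfn x (?F x)" for x
  have P: "P x \<longleftrightarrow> x \<epsilon> cantor \<and> le_T z0 x \<and> le_T x (?F x)" for x
    unfolding P_def using le_T_iff Fc z0 by metis
  have DP: "definable (\<lambda>e. P (e 0))" unfolding P_def by (intro definable_intros_set definable_le_T)
  have IP: "P y" if "x \<epsilon> cantor" "y \<epsilon> cantor" "P x" "le_T x y" "le_T y x" for x y
  proof -
    have "le_T z0 y" using that P le_T_trans by blast
    moreover have "le_T y (?F x)" using that P le_T_trans[of "?F x" x y] Fc by blast
    moreover have "le_T (?F x) (?F y)" using inv that P calculation(1) by blast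
    ultimately show ?thesis using that P le_T_trans[of "?F y" "?F x" y] Fc by blast
  qed
  then have IP': "\<forall>x y. x \<epsilon> cantor \<and> y \<epsilon> cantor \<and> P x \<and> le_T x y \<and> le_T y x \<longrightarrow> P y" by blast
  show ?thesis
  proof (cases rule: TD_dichotomy[OF assms(1) DP IP'])
    case (1 z)
    have "le_T x (app f x)" if "x \<epsilon> cone z" for x
      using 1(2)[OF that] P[of x] F by simp
    then have "on_cone (\<lambda>x. le_T x (app f x))"
      unfolding on_cone_def using 1(1) by blast
    then show ?thesis ..
  next
    case (2 z1)
    obtain w where w [simp]: "w \<epsilon> cantor" and w0: "le_T z0 w" and w1: "le_T z1 w"
      using upper_bound[OF z0 2(1)] .
    \<comment> \<open>On the cone above \<open>w\<close> the reals \<open>x \<le>\<^sub>T f(x)\<close> are excluded.\<close>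
    have ge: "le_T z0 x" "\<not> P x" if "x \<epsilon> cantor" "le_T w x" for x
      using le_T_trans[OF that(1) w] w0 w1 that 2 mem_cone by blast+
    have const: "?F x = ?F y" if "x \<epsilon> cantor" "y \<epsilon> cantor" "le_T w x" "le_T x y" "le_T y x" for x y
    proof (rule ccontr)
      assume "?F x \<noteq> ?F y"
      moreover have "le_T z0 y" using le_T_trans[of y x z0] ge that by blast
      ultimately have "le_T x (?F x)" using local_dichotomy[OF f z0 U] that ge by blast
      then show False using ge that P by blast
    qed
    define good where "good n z \<longleftrightarrow> (\<forall>x y. x \<epsilon> cantor \<and> y \<epsilon> cantor \<and> le_T_dfn z x \<and> le_T_dfn z y \<longrightarrow>
      app_dfn (?F x) n = app_dfn (?F y) n)" for n z
    have good: "good n z \<longleftrightarrow> (\<forall>x y. x \<epsilon> cantor \<and> y \<epsilon> cantor \<and> le_T z x \<and> le_T z y \<longrightarrow>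
      app (?F x) n = app (?F y) n)" if "n \<epsilon> omega" "z \<epsilon> cantor" for n z
      unfolding good_def using le_T_iff[OF that(2)] app_dfn_cantor[OF Fc that(1)] by metis
    obtain r where r: "r \<epsilon> cantor" "\<And>n. n \<epsilon> omega \<Longrightarrow> good n r"
    proof (rule countable_cones[of good])
      show "definable (\<lambda>e. good (e 0) (e 1))"
        unfolding good_def by (intro definable_intros_set definable_le_T)
      show "good n z'" if "z \<epsilon> cantor" "z' \<epsilon> cantor" "le_T z z'" "good n z" for n z z'
        using that le_T_trans[OF _ that(2,3)] le_T_iff unfolding good_def by metis
      show "\<exists>z. z \<epsilon> cantor \<and> good n z" if n: "n \<epsilon> omega" for n
      proof -
        define B where "B x \<longleftrightarrow> x \<epsilon> cantor \<and> le_T_dfn w x \<and> app_dfn (?F x) n = num 0" for x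
        have B: "B x \<longleftrightarrow> x \<epsilon> cantor \<and> le_T w x \<and> app (?F x) n = num 0" for x
          unfolding B_def using le_T_iff[OF w] app_dfn_cantor[OF Fc n] by metis
        have DB: "definable (\<lambda>e. B (e 0))" unfolding B_def by
            (intro definable_intros_set definable_le_T)
        have IB: "B y" if "x \<epsilon> cantor" "y \<epsilon> cantor" "B x" "le_T x y" "le_T y x" for x y
          using that const le_T_trans[of y x w] unfolding B by metis
        then have IB': "\<forall>x y. x \<epsilon> cantor \<and> y \<epsilon> cantor \<and> B x \<and> le_T x y \<and> le_T y x \<longrightarrow> B y"
          by blast
        show ?thesis
        proof (cases rule: TD_dichotomy[OF assms(1) DB IB'])
          case (1 z)
          then have "good n z" unfolding good[OF n 1(1)] using B mem_cone by metis
          then show ?thesis using 1 by blast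
        next
          case (2 z)
          obtain z' where z': "z' \<epsilon> cantor" "le_T z z'" "le_T w z'"
            using upper_bound[OF 2(1) w] .
          have "app (?F x) n = num 1" if x: "x \<epsilon> cantor" "le_T z' x" for x
          proof -
            have "le_T z x" "le_T w x" using le_T_trans[OF x(1) z'(1)] z' x by blast+
            then show ?thesis using 2 mem_cone B x cantor_bit[OF Fc[OF x(1)] n] by metis
          qed
          then have "good n z'" unfolding good[OF n z'(1)] by metis
          then show ?thesis using z' by blast
        qed
      qed
    qed blast
    have "app f x = ?F r" if "x \<epsilon> cone r" for x
    proof -
      have x: "x \<epsilon> cantor" "le_T r x" using that mem_cone r by auto
      have "app (?F x) n = app (?F r) n" if n: "n \<epsilon> omega" for n
        using r(2)[OF n] le_T_refl[OF r(1)] x r(1) unfolding good[OF n r(1)] by blast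
      then show ?thesis using cantor_ext[of "?F x" "?F r"] x r F by simp
    qed
    then have "on_cone (\<lambda>x. app f x = ?F r)" unfolding on_cone_def using r by blast
    then show ?thesis using r(1) Fc by blast
  qed
qed

end

theorem theorem2p1:
  fixes mem :: "'v \<Rightarrow> 'v \<Rightarrow> bool" and f :: 'v
  assumes "ZF_DC mem"
    and "set_structure.TD mem"
    and "set_structure.is_fun mem f (set_structure.cantor mem) (set_structure.cantor mem)"
    and "set_structure.UTI_on_cone mem f"
  shows "set_structure.on_cone mem (\<lambda>x. set_structure.le_T mem x (set_structure.app mem f x)) \<or>
    (\<exists>y. mem y (set_structure.cantor mem) \<and>
      set_structure.on_cone mem (\<lambda>x. set_structure.app mem f x = y))"
  using ZF_DC.uniform_martin[OF assms] .

end
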